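(* Let $\alpha>0$ and let $U^\alpha=(U^\alpha_t)_{t\ge 0}$ be a Bessel process $\mathrm{BES}(\alpha,0)$ of dimension $\alpha$ starting from $0$, i.e. $U^\alpha_t=\sqrt{Y^\alpha_t}$ where $Y^\alpha$ is the unique (nonnegative) solution of $$dY^\alpha_t=\alpha\,dt+2\sqrt{Y^\alpha_t}\,dB_t,\qquad Y^\alpha_0=0,$$ and $B$ is a standard Brownian motion on a filtered probability space $(\Omega,\mathcal{F},\{\mathcal{F}_t\},\mathbb{P})$ satisfying the usual conditions. Let $U^{\alpha,*}_t=\sup_{0\le s\le t}|U^\alpha_s|$. Then for every moderate function $F$ there exist two constants $c_{\alpha,F},C_{\alpha,F}>0$ such that for every stopping time $\tau$ of the filtration $\{\mathcal{F}_t\}$, $$c_{\alpha,F}\,\mathbb{E}F(\sqrt{\tau})\le\mathbb{E}F(U^{\alpha,*}_\tau)\le C_{\alpha,F}\,\mathbb{E}F(\sqrt{\tau}).$$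
   Context: $\mathbb{R}_+=[0,\infty)$. A function $F:\mathbb{R}_+\to\mathbb{R}_+$ is called moderate if (a) it is continuous, increasing (in the weak sense) and $F(0)=0$, and (b) there exists $\beta>1$ such that $\sup_{x>0}F(\beta x)/F(x)<\infty$, with the conventions $0/0=1$ and $x/0=\infty$ for $x>0$. *)

theory Defs
  imports "HOL-Probability.Probability"
begin

section \<open>Moderate functions\<close>

text \<open>Quotient of two nonnegative reals with \<open>0/0 = 1\<close> and \<open>x/0 = \<infinity>\<close> for \<open>x > 0\<close>
  (neither \<^typ>\<open>real\<close> nor \<^typ>\<open>ennreal\<close> division has these conventions).\<close>

definition ratio :: "real \<Rightarrow> real \<Rightarrow> ennreal" where
  "ratio a b = (if b = 0 then (if a = 0 then 1 else \<infinity>) else ennreal (a / b))"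

text \<open>Functions on \<open>[0,\<infinity>)\<close> are total functions on \<^typ>\<open>real\<close> of which only the values on
  \<^term>\<open>{0::real..}\<close> matter.\<close>

definition moderate :: "(real \<Rightarrow> real) \<Rightarrow> bool" where
  "moderate F \<longleftrightarrow>
     (\<forall>x\<ge>0. 0 \<le> F x) \<and> continuous_on {0..} F \<and> mono_on {0..} F \<and> F 0 = 0 \<and>
     (\<exists>\<beta>>1. (SUP x\<in>{0<..}. ratio (F (\<beta> * x)) (F x)) < \<infinity>)"

text \<open>Stopping times may be infinite, so increasing functions on \<open>[0,\<infinity>)\<close> are extended to
  \<open>[0,\<infinity>]\<close> by \<open>F \<infinity> = lim F x = sup F x\<close> as \<open>x \<rightarrow> \<infinity>\<close>.\<close>

definition ext_inf :: "(real \<Rightarrow> real) \<Rightarrow> ennreal \<Rightarrow> ennreal" where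
  "ext_inf F x = (if x = \<infinity> then (SUP y\<in>{0..}. ennreal (F y)) else ennreal (F (enn2real x)))"

definition esqrt :: "ennreal \<Rightarrow> ennreal" where
  "esqrt x = (if x = \<infinity> then \<infinity> else ennreal (sqrt (enn2real x)))"

section \<open>Filtered probability spaces and Brownian motion\<close>

text \<open>Filtrations are indexed by \<^typ>\<open>ennreal\<close>, i.e. by \<open>[0,\<infinity>]\<close>, so that the library's
  \<^const>\<open>stopping_time\<close> covers stopping times with values in \<open>[0,\<infinity>]\<close>. The member at \<open>\<infinity>\<close> is an
  arbitrary sub-\<open>\<sigma>\<close>-algebra containing all the others; it imposes no condition on a stopping
  time. Processes are indexed by \<^typ>\<open>real\<close> and only times \<open>t \<ge> 0\<close> matter. The inclusion
  \<open>null_complete\<close> also forces \<open>M\<close> itself to be complete.\<close>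

locale usual_filtered_space = prob_space M + filtration "space M" Ft
  for M :: "'a measure" and Ft :: "ennreal \<Rightarrow> 'a measure" +
  assumes sub_M: "\<And>t. subalgebra M (Ft t)"
    and null_complete: "\<And>A N. N \<in> null_sets M \<Longrightarrow> A \<subseteq> N \<Longrightarrow> A \<in> sets (Ft 0)"
    and right_cont: "\<And>t. t < \<infinity> \<Longrightarrow> sets (Ft t) = (\<Inter>u\<in>{t<..}. sets (Ft u))"

definition adapted :: "(ennreal \<Rightarrow> 'a measure) \<Rightarrow> (real \<Rightarrow> 'a \<Rightarrow> real) \<Rightarrow> bool" where
  "adapted Ft X \<longleftrightarrow> (\<forall>t\<ge>0. X t \<in> borel_measurable (Ft (ennreal t)))"

definition continuous_adapted ::
    "'a measure \<Rightarrow> (ennreal \<Rightarrow> 'a measure) \<Rightarrow> (real \<Rightarrow> 'a \<Rightarrow> real) \<Rightarrow> bool" where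
  "continuous_adapted M Ft X \<longleftrightarrow>
     adapted Ft X \<and> (AE \<omega> in M. continuous_on {0..} (\<lambda>t. X t \<omega>))"

definition brownian_motion ::
    "'a measure \<Rightarrow> (ennreal \<Rightarrow> 'a measure) \<Rightarrow> (real \<Rightarrow> 'a \<Rightarrow> real) \<Rightarrow> bool" where
  "brownian_motion M Ft B \<longleftrightarrow>
     continuous_adapted M Ft B \<and>
     (AE \<omega> in M. B 0 \<omega> = 0) \<and>
     (\<forall>s t. 0 \<le> s \<and> s < t \<longrightarrow>
        distributed M lborel (\<lambda>\<omega>. B t \<omega> - B s \<omega>) (\<lambda>x. ennreal (normal_density 0 (sqrt (t - s)) x)) \<and>
        prob_space.indep_set M (sets (Ft (ennreal s)))
          {(\<lambda>\<omega>. B t \<omega> - B s \<omega>) -` A \<inter> space M | A. A \<in> sets borel})"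

section \<open>The Ito integral\<close>

definition progressive :: "(ennreal \<Rightarrow> 'a measure) \<Rightarrow> (real \<Rightarrow> 'a \<Rightarrow> real) \<Rightarrow> bool" where
  "progressive Ft H \<longleftrightarrow>
     (\<forall>T\<ge>0. (\<lambda>(t, \<omega>). H t \<omega>) \<in> borel_measurable (restrict_space borel {0..T} \<Otimes>\<^sub>M Ft (ennreal T)))"

text \<open>A list of triples \<open>(a, b, \<xi>)\<close> encodes the simple process \<open>\<Sum> \<xi> 1\<^bsub>(a,b]\<^esub>\<close>, where \<open>\<xi>\<close> is bounded
  and measurable with respect to the \<open>\<sigma>\<close>-algebra at time \<open>a\<close>. The intervals may overlap, which
  does not enlarge the class of simple processes.\<close>

type_synonym 'a simple = "(real \<times> real \<times> ('a \<Rightarrow> real)) list"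

definition is_simple :: "(ennreal \<Rightarrow> 'a measure) \<Rightarrow> 'a simple \<Rightarrow> bool" where
  "is_simple Ft S \<longleftrightarrow>
     (\<forall>(a, b, \<xi>) \<in> set S. 0 \<le> a \<and> a \<le> b \<and> \<xi> \<in> borel_measurable (Ft (ennreal a)) \<and>
        (\<exists>K. \<forall>\<omega>\<in>space (Ft (ennreal a)). \<bar>\<xi> \<omega>\<bar> \<le> K))"

definition simple_process :: "'a simple \<Rightarrow> real \<Rightarrow> 'a \<Rightarrow> real" where
  "simple_process S t \<omega> = (\<Sum>(a, b, \<xi>)\<leftarrow>S. \<xi> \<omega> * indicator {a<..b} t)"

definition simple_integral :: "(real \<Rightarrow> 'a \<Rightarrow> real) \<Rightarrow> 'a simple \<Rightarrow> real \<Rightarrow> 'a \<Rightarrow> real" where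
  "simple_integral B S t \<omega> = (\<Sum>(a, b, \<xi>)\<leftarrow>S. \<xi> \<omega> * (B (min b t) \<omega> - B (min a t) \<omega>))"

definition tendsto_zero_in_prob :: "'a measure \<Rightarrow> (nat \<Rightarrow> 'a \<Rightarrow> ennreal) \<Rightarrow> bool" where
  "tendsto_zero_in_prob M X \<longleftrightarrow>
     (\<forall>k. X k \<in> borel_measurable M) \<and>
     (\<forall>\<epsilon>>0. (\<lambda>k. measure M {\<omega> \<in> space M. X k \<omega> > ennreal \<epsilon>}) \<longlonglongrightarrow> 0)"

text \<open>\<open>I\<close> is (a version of) the process \<open>\<integral>\<^sub>0\<^sup>t H dB\<close>, for progressive \<open>H\<close> with locally square
  integrable paths: the limit, uniform on compact time intervals in probability, of integrals of
  simple processes that converge to \<open>H\<close> in \<open>L\<^sup>2([0,T])\<close> in probability for every \<open>T\<close>. By the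
  Ito isometry and localization such an \<open>I\<close> exists, does not depend on the approximating
  sequence, and is unique up to indistinguishability. On a complete space the two
  sequences below are automatically measurable, so measurability in
  \<^const>\<open>tendsto_zero_in_prob\<close> is no restriction.\<close>

definition ito_integral ::
    "'a measure \<Rightarrow> (ennreal \<Rightarrow> 'a measure) \<Rightarrow> (real \<Rightarrow> 'a \<Rightarrow> real) \<Rightarrow>
     (real \<Rightarrow> 'a \<Rightarrow> real) \<Rightarrow> (real \<Rightarrow> 'a \<Rightarrow> real) \<Rightarrow> bool" where
  "ito_integral M Ft B H I \<longleftrightarrow>
     progressive Ft H \<and>
     (AE \<omega> in M. \<forall>T\<ge>0. (\<integral>\<^sup>+s\<in>{0..T}. ennreal ((H s \<omega>)\<^sup>2) \<partial>lborel) < \<infinity>) \<and>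
     continuous_adapted M Ft I \<and>
     (\<exists>S :: nat \<Rightarrow> 'a simple.
        (\<forall>k. is_simple Ft (S k)) \<and>
        (\<forall>T\<ge>0.
           tendsto_zero_in_prob M
             (\<lambda>k \<omega>. \<integral>\<^sup>+s\<in>{0..T}. ennreal ((simple_process (S k) s \<omega> - H s \<omega>)\<^sup>2) \<partial>lborel) \<and>
           tendsto_zero_in_prob M
             (\<lambda>k \<omega>. SUP s\<in>{0..T}. ennreal \<bar>simple_integral B (S k) s \<omega> - I s \<omega>\<bar>)))"

section \<open>Bessel processes\<close>

text \<open>Nonnegative solutions of \<open>dY = \<alpha> dt + 2 sqrt Y dB\<close>, \<open>Y\<^sub>0 = 0\<close>; the drift integral
  \<open>\<integral>\<^sub>0\<^sup>t \<alpha> ds\<close> is \<open>\<alpha> t\<close>.\<close>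

definition squared_bessel ::
    "'a measure \<Rightarrow> (ennreal \<Rightarrow> 'a measure) \<Rightarrow> (real \<Rightarrow> 'a \<Rightarrow> real) \<Rightarrow> real \<Rightarrow>
     (real \<Rightarrow> 'a \<Rightarrow> real) \<Rightarrow> bool" where
  "squared_bessel M Ft B \<alpha> Y \<longleftrightarrow>
     continuous_adapted M Ft Y \<and>
     (AE \<omega> in M. \<forall>t\<ge>0. 0 \<le> Y t \<omega>) \<and>
     (\<exists>I. ito_integral M Ft B (\<lambda>t \<omega>. 2 * sqrt (Y t \<omega>)) I \<and>
          (AE \<omega> in M. \<forall>t\<ge>0. Y t \<omega> = \<alpha> * t + I t \<omega>))"

definition bessel_process ::
    "'a measure \<Rightarrow> (ennreal \<Rightarrow> 'a measure) \<Rightarrow> (real \<Rightarrow> 'a \<Rightarrow> real) \<Rightarrow> real \<Rightarrow>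
     (real \<Rightarrow> 'a \<Rightarrow> real) \<Rightarrow> bool" where
  "bessel_process M Ft B \<alpha> U \<longleftrightarrow>
     (\<exists>Y. squared_bessel M Ft B \<alpha> Y \<and> (\<forall>t\<ge>0. \<forall>\<omega>\<in>space M. U t \<omega> = sqrt (Y t \<omega>)))"

text \<open>\<open>sup |U\<^sub>s|\<close> over real \<open>s\<close> with \<open>0 \<le> s \<le> t\<close>; over all \<open>s \<ge> 0\<close> if \<open>t = \<infinity>\<close>.\<close>

definition running_max :: "(real \<Rightarrow> 'a \<Rightarrow> real) \<Rightarrow> ennreal \<Rightarrow> 'a \<Rightarrow> ennreal" where
  "running_max U t \<omega> = (SUP s\<in>{s. 0 \<le> s \<and> ennreal s \<le> t}. ennreal \<bar>U s \<omega>\<bar>)"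

end

theory Submission
  imports Defs
begin

text \<open>
  Both inequalities come from good-\<open>\<lambda>\<close> inequalities relating the maximum \<open>U\<^sup>*\<close> of the Bessel process and
  the clock \<open>sqrt \<tau>\<close>:
  \<open>P(U\<^sup>* > 2l, sqrt \<tau> \<le> \<delta>l) \<le> \<epsilon> P(U\<^sup>* > l)\<close> and \<open>P(sqrt \<tau> > 2l, U\<^sup>* \<le> \<delta>l) \<le> \<epsilon> P(sqrt \<tau> > l)\<close>, where \<open>\<epsilon>\<close>
  is of order \<open>\<delta>\<^sup>2\<close>. Integrated against \<open>dF\<close>, such an inequality bounds one moment by the other
  once \<open>\<epsilon>\<close> is small compared with the growth constant of the moderate function \<open>F\<close>
  (\<open>good_lambda_moment_inequality\<close>). The constants depend on \<open>\<alpha>\<close> and \<open>F\<close> only, because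
  \<open>\<epsilon>\<close> depends only on \<open>\<alpha>\<close> and \<open>\<delta>\<close>.

  The good-\<open>\<lambda>\<close> inequalities (\<open>bessel_max_good_lambda\<close>, \<open>bessel_clock_good_lambda\<close>) are read off from
  \<open>Y\<^sub>t = \<alpha>t + I\<^sub>t\<close>, where \<open>Y = U\<^sup>2\<close> and \<open>I = \<integral> 2 sqrt Y dB\<close>. For the maximum to grow in a short time, \<open>I\<close> has to grow; for
  \<open>Y\<close> to stay small during a long time, \<open>I\<close> has to cancel the drift. In both situations \<open>Y\<close> is bounded
  between two stopping times \<open>\<sigma>\<close> and \<open>\<theta>\<close>, so that the quadratic variation \<open>\<integral> 4Y ds\<close> of \<open>I\<close> is too small for
  an increment of that size.

  Hence all the stochastic calculus that is needed is one second-moment tail bound for the increment of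
  an Ito integral between stopping times, with the factor \<open>P(\<sigma> < \<theta>)\<close> (\<open>ito_increment_tail\<close>). It is proved
  directly from the approximation by simple processes that defines the integral: on a grid refining
  the endpoints of a simple process, the discrete isometry (\<open>martingale_transform_isometry\<close>) applies
  to the integral that is switched off when its energy budget is exhausted
  (\<open>stopped_energy_bounded_sum\<close>), and with high probability neither the switching nor the
  discretisation matters.
\<close>

section \<open>Moderate functions and good-\<open>\<lambda>\<close> inequalities\<close>

lemma moderateD:
  assumes "moderate F"
  shows moderate_nonneg: "0 \<le> x \<Longrightarrow> 0 \<le> F x"
    and moderate_mono: "0 \<le> x \<Longrightarrow> x \<le> y \<Longrightarrow> F x \<le> F y"
    and moderate_zero: "F 0 = 0"
    and moderate_cont: "continuous_on UNIV (\<lambda>x. F (max 0 x))"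
proof -
  have *: "\<forall>x\<ge>0. 0 \<le> F x" "mono_on {0..} F" "F 0 = 0" and cont: "continuous_on {0..} F"
    using assms unfolding moderate_def by blast+
  show "0 \<le> x \<Longrightarrow> 0 \<le> F x" "F 0 = 0" using * by auto
  show "0 \<le> x \<Longrightarrow> x \<le> y \<Longrightarrow> F x \<le> F y" by (rule mono_onD[OF *(2)]) auto
  show "continuous_on UNIV (\<lambda>x. F (max 0 x))"
    by (rule continuous_on_compose2[OF cont]) (intro continuous_intros, simp add: subset_eq)
qed

text \<open>Iterating the doubling-type condition: \<open>\<beta> ^ n\<close> exceeds any given factor. A zero of \<open>F\<close> at a
  positive point does no harm, because the convention \<open>x/0 = \<infinity>\<close> then forces \<open>F\<close> to vanish at the
  dilated point as well.\<close>

lemma moderate_dilation: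
  assumes "moderate F" "0 < c"
  shows "\<exists>K\<ge>1. \<forall>x\<ge>0. F (c * x) \<le> K * F x"
proof -
  note nn = moderate_nonneg[OF assms(1)] and F0 = moderate_zero[OF assms(1)]
  from assms(1) obtain \<beta> where \<beta>: "\<beta> > 1"
    and fin: "(SUP x\<in>{0<..}. ratio (F (\<beta> * x)) (F x)) < \<infinity>"
    unfolding moderate_def by blast
  define S where "S = (SUP x\<in>{0<..}. ratio (F (\<beta> * x)) (F x))"
  define k where "k = max 1 (enn2real S)"
  have S: "S = ennreal (enn2real S)"
    using fin by (simp add: S_def)
  have step: "F (\<beta> * x) \<le> k * F x" if "x \<ge> 0" for x
  proof (cases "x = 0")
    case False
    with that have x: "x > 0" by simp
    have le: "ratio (F (\<beta> * x)) (F x) \<le> ennreal (enn2real S)"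
      unfolding S[symmetric] unfolding S_def using x by (intro SUP_upper) auto
    show ?thesis
    proof (cases "F x = 0")
      case True
      then have "F (\<beta> * x) = 0"
        using le by (auto simp: ratio_def top_unique split: if_splits)
      then show ?thesis using True by simp
    next
      case False
      then have pos: "F x > 0" using nn[of x] x by simp
      then have "F (\<beta> * x) / F x \<le> enn2real S"
        using le False by (simp add: ratio_def)
      then have "F (\<beta> * x) / F x \<le> k" by (simp add: k_def)
      then show ?thesis using pos by (simp add: field_simps)
    qed
  qed (simp add: F0)
  have k: "k \<ge> 1" by (simp add: k_def)
  have iter: "F (\<beta> ^ n * x) \<le> k ^ n * F x" if "x \<ge> 0" for n x
  proof (induction n)
    case (Suc n)
    have "F (\<beta> ^ Suc n * x) = F (\<beta> * (\<beta> ^ n * x))" by (simp add: mult.assoc)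
    also have "\<dots> \<le> k * F (\<beta> ^ n * x)" using that \<beta> by (intro step) auto
    also have "\<dots> \<le> k * (k ^ n * F x)" using Suc k by (intro mult_left_mono) auto
    finally show ?case by (simp add: mult.assoc)
  qed simp
  obtain n where n: "c < \<beta> ^ n" using real_arch_pow[OF \<beta>] by blast
  have "F (c * x) \<le> k ^ n * F x" if "x \<ge> 0" for x
  proof -
    have "F (c * x) \<le> F (\<beta> ^ n * x)"
      using that n assms(2) by (intro moderate_mono[OF assms(1)] mult_right_mono) auto
    also note iter[OF that]
    finally show ?thesis .
  qed
  then show ?thesis using k by (intro exI[of _ "k ^ n"]) auto
qed

text \<open>The measure \<open>dF\<close> on \<open>(0,\<infinity>)\<close>, extended by zero to the negative half line. Its distribution
  function turns moments of \<open>F\<close> into integrals of tail probabilities.\<close>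

definition stieltjes :: "(real \<Rightarrow> real) \<Rightarrow> real measure" where
  "stieltjes F = interval_measure (\<lambda>x. F (max 0 x))"

lemma sets_stieltjes[measurable_cong, simp]: "sets (stieltjes F) = sets borel"
  by (simp add: stieltjes_def)

lemma
  assumes "moderate F"
  shows sigma_finite_stieltjes: "sigma_finite_measure (stieltjes F)"
    and emeasure_stieltjes: "0 \<le> b \<Longrightarrow> emeasure (stieltjes F) {0<..b} = ennreal (F b)"
proof -
  have mono: "\<And>x y. x \<le> y \<Longrightarrow> F (max 0 x) \<le> F (max 0 y)"
    by (rule moderate_mono[OF assms]) auto
  have cont: "\<And>a. continuous (at_right a) (\<lambda>x. F (max 0 x))"
    using moderate_cont[OF assms] continuous_at_imp_continuous_at_within
    by (auto simp: continuous_on_eq_continuous_at)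
  show "sigma_finite_measure (stieltjes F)"
    unfolding stieltjes_def by (rule sigma_finite_interval_measure) (fact mono cont)+
  show "emeasure (stieltjes F) {0<..b} = ennreal (F b)" if "0 \<le> b"
    unfolding stieltjes_def using that moderate_zero[OF assms]
    by (subst emeasure_interval_measure_Ioc[OF that mono cont]) simp_all
qed

text \<open>The layer-cake formula \<open>F x = \<integral> 1{l < x} dF(l)\<close>. With the strict
  inequality the set is an increasing union of bounded intervals \<open>(0,r]\<close>, also for \<open>x = \<infinity>\<close>, and continuity
  of \<open>F\<close> identifies the limit for real \<open>x\<close>.\<close>

lemma ext_inf_eq_stieltjes:
  assumes "moderate F"
  shows "ext_inf F x = emeasure (stieltjes F) {l. 0 < l \<and> ennreal l < x}"
proof (cases x)
  case top
  have "{l::real. 0 < l \<and> ennreal l < top} = (\<Union>n. {0<..real n})"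
    by (auto intro: real_arch_simple)
  then have "emeasure (stieltjes F) {l. 0 < l \<and> ennreal l < top} = (SUP n. emeasure (stieltjes F) {0<..real n})"
    by (subst SUP_emeasure_incseq) (auto simp: incseq_def)
  also have "\<dots> = (SUP n. ennreal (F (real n)))"
    using assms by (simp add: emeasure_stieltjes)
  also have "\<dots> = (SUP y\<in>{0..}. ennreal (F y))"
  proof (rule SUP_eq)
    fix y :: real assume "y \<in> {0..}"
    then have "ennreal (F y) \<le> ennreal (F (real (nat \<lceil>y\<rceil>)))"
      by (intro ennreal_leI moderate_mono[OF assms] real_nat_ceiling_ge) simp_all
    then show "\<exists>n\<in>UNIV. ennreal (F y) \<le> ennreal (F (real n))" by blast
  next
    fix n :: nat
    show "\<exists>y\<in>{0..}. ennreal (F (real n)) \<le> ennreal (F y)"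
      by (rule bexI[of _ "real n"]) simp_all
  qed
  finally show ?thesis using top by (simp add: ext_inf_def)
next
  case (real r)
  have cont: "continuous_on {0..} F" using assms unfolding moderate_def by blast
  define r' where "r' n = max 0 (r - inverse (real (Suc n)))" for n
  have "(\<lambda>n. max 0 (r - inverse (real (Suc n)))) \<longlonglongrightarrow> max 0 (r - 0)"
    by (intro tendsto_intros LIMSEQ_inverse_real_of_nat)
  then have r'_lim: "r' \<longlonglongrightarrow> r" using real unfolding r'_def by (simp add: max_def)
  have r'_mono: "r' m \<le> r' n" if "m \<le> n" for m n
    using that unfolding r'_def by (intro max.mono order_refl diff_mono le_imp_inverse_le) auto
  have "l < r \<longleftrightarrow> (\<exists>n. l \<le> r' n)" if l: "0 < l" for l
  proof
    assume "l < r"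
    then obtain n where "inverse (real (Suc n)) < r - l"
      using reals_Archimedean[of "r - l"] by auto
    then show "\<exists>n. l \<le> r' n" by (intro exI[of _ n]) (simp add: r'_def)
  next
    assume "\<exists>n. l \<le> r' n"
    then obtain n where n: "l \<le> r' n" ..
    have "inverse (real (Suc n)) > 0" by (intro positive_imp_inverse_positive) simp
    then show "l < r" using n l unfolding r'_def by (cases "0 \<le> r - inverse (real (Suc n))") linarith+
  qed
  then have "{l. 0 < l \<and> ennreal l < ennreal r} = (\<Union>n. {0<..r' n})"
    by (auto simp: ennreal_less_iff)
  moreover have "(\<lambda>n. emeasure (stieltjes F) {0<..r' n}) \<longlonglongrightarrow> emeasure (stieltjes F) (\<Union>n. {0<..r' n})"
  proof (rule Lim_emeasure_incseq)
    show "incseq (\<lambda>n. {0<..r' n})"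
    proof (rule incseq_SucI)
      fix n show "{0<..r' n} \<subseteq> {0<..r' (Suc n)}" using r'_mono[of n "Suc n"] by auto
    qed
  qed auto
  moreover have "emeasure (stieltjes F) {0<..r' n} = ennreal (F (r' n))" for n
    using assms by (intro emeasure_stieltjes) (auto simp: r'_def)
  moreover have "(\<lambda>n. ennreal (F (r' n))) \<longlonglongrightarrow> ennreal (F r)"
  proof (rule tendsto_ennrealI)
    show "(\<lambda>n. F (r' n)) \<longlonglongrightarrow> F r"
      using real by (intro continuous_on_tendsto_compose[OF cont r'_lim] always_eventually allI) (simp_all add: r'_def)
  qed
  ultimately have "ennreal (F r) = emeasure (stieltjes F) {l. 0 < l \<and> ennreal l < ennreal r}"
    by (simp add: LIMSEQ_unique)
  then show ?thesis using real by (simp add: ext_inf_def)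
qed

lemma ext_inf_mono:
  assumes "moderate F" "x \<le> y"
  shows "ext_inf F x \<le> ext_inf F y"
  unfolding ext_inf_eq_stieltjes[OF assms(1)] using assms(2)
  by (intro emeasure_mono) (auto intro: less_le_trans)

lemma ext_inf_measurable [measurable]:
  assumes "moderate F"
  shows "ext_inf F \<in> borel_measurable borel"
proof -
  have [measurable]: "(\<lambda>x. F (max 0 x)) \<in> borel_measurable borel"
    by (rule borel_measurable_continuous_onI[OF moderate_cont[OF assms]])
  have "ext_inf F = (\<lambda>x. if x = \<infinity> then (SUP y\<in>{0..}. ennreal (F y)) else ennreal (F (max 0 (enn2real x))))"
    by (auto simp: ext_inf_def fun_eq_iff max_def)
  also have "\<dots> \<in> borel_measurable borel" by measurable
  finally show ?thesis .
qed

lemma ext_inf_dilation: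
  assumes F: "moderate F" and c: "0 < c" and K: "0 \<le> K" "\<And>x. x \<ge> 0 \<Longrightarrow> F (c * x) \<le> K * F x"
  shows "ext_inf F (ennreal c * x) \<le> ennreal K * ext_inf F x"
proof (cases x)
  case top
  note nn = moderate_nonneg[OF F]
  have "(SUP y\<in>{0..}. ennreal (F y)) \<le> ennreal K * (SUP y\<in>{0..}. ennreal (F y))"
  proof (rule SUP_least)
    fix y :: real assume y: "y \<in> {0..}"
    have "ennreal (F y) \<le> ennreal (K * F (y / c))"
      using K(2)[of "y / c"] c y by (intro ennreal_leI) auto
    also have "\<dots> = ennreal K * ennreal (F (y / c))"
      using K c y nn by (intro ennreal_mult) auto
    also have "\<dots> \<le> ennreal K * (SUP y\<in>{0..}. ennreal (F y))"
      using y c by (intro mult_left_mono SUP_upper) auto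
    finally show "ennreal (F y) \<le> \<dots>" .
  qed
  then show ?thesis using c top by (simp add: ext_inf_def ennreal_mult_top)
next
  case (real r)
  then show ?thesis using K c moderate_nonneg[OF F]
    by (simp add: ext_inf_def ennreal_mult[symmetric]) 
qed

lemma (in prob_space) nn_integral_ext_inf:
  assumes F: "moderate F" and X[measurable]: "X \<in> borel_measurable M"
  shows "(\<integral>\<^sup>+\<omega>. ext_inf F (X \<omega>) \<partial>M)
    = (\<integral>\<^sup>+l. indicator {0<..} l * emeasure M {\<omega>\<in>space M. ennreal l < X \<omega>} \<partial>stieltjes F)"
proof -
  interpret S: sigma_finite_measure "stieltjes F" by (rule sigma_finite_stieltjes[OF F])
  interpret P: pair_sigma_finite M "stieltjes F" ..
  let ?f = "\<lambda>\<omega> l. indicator {\<omega>. 0 < l \<and> ennreal l < X \<omega>} \<omega> :: ennreal"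
  have "(\<integral>\<^sup>+\<omega>. ext_inf F (X \<omega>) \<partial>M) = (\<integral>\<^sup>+\<omega>. (\<integral>\<^sup>+l. ?f \<omega> l \<partial>stieltjes F) \<partial>M)"
    unfolding ext_inf_eq_stieltjes[OF F]
    by (intro nn_integral_cong)
       (simp add: nn_integral_indicator[symmetric] indicator_def del: nn_integral_indicator)
  also have "\<dots> = (\<integral>\<^sup>+l. (\<integral>\<^sup>+\<omega>. ?f \<omega> l \<partial>M) \<partial>stieltjes F)"
    by (intro P.Fubini'[symmetric]) measurable
  also have "\<dots> = (\<integral>\<^sup>+l. indicator {0<..} l * emeasure M {\<omega>\<in>space M. ennreal l < X \<omega>} \<partial>stieltjes F)"
  proof (intro nn_integral_cong)
    fix l
    have "(\<integral>\<^sup>+\<omega>. ?f \<omega> l \<partial>M) = (\<integral>\<^sup>+\<omega>. indicator {0<..} l * indicator {\<omega>\<in>space M. ennreal l < X \<omega>} \<omega> \<partial>M)"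
      by (intro nn_integral_cong) (auto simp: indicator_def)
    then show "(\<integral>\<^sup>+\<omega>. ?f \<omega> l \<partial>M) = indicator {0<..} l * emeasure M {\<omega>\<in>space M. ennreal l < X \<omega>}"
      by (simp add: nn_integral_cmult)
  qed
  finally show ?thesis .
qed

text \<open>Truncation makes moments finite, and monotone convergence removes it by this formula.\<close>

lemma ext_inf_SUP_min:
  assumes F: "moderate F"
  shows "ext_inf F x = (SUP m. ext_inf F (min x (of_nat m)))"
proof -
  have "{l. 0 < l \<and> ennreal l < x} = (\<Union>m. {l. 0 < l \<and> ennreal l < min x (of_nat m)})"
  proof (intro set_eqI iffI)
    fix l assume l: "l \<in> {l. 0 < l \<and> ennreal l < x}"
    obtain m where "l < real m" using reals_Archimedean2 by blast
    then have "ennreal l < of_nat m" using l by (simp add: ennreal_of_nat_eq_real_of_nat ennreal_less_iff)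
    then show "l \<in> (\<Union>m. {l. 0 < l \<and> ennreal l < min x (of_nat m)})" using l by auto
  qed auto
  moreover have "incseq (\<lambda>m. {l. 0 < l \<and> ennreal l < min x (of_nat m)})"
  proof (rule incseq_SucI)
    fix m
    have "min x (of_nat m) \<le> min x (of_nat (Suc m))" by (intro min.mono order_refl of_nat_mono) simp
    then show "{l. 0 < l \<and> ennreal l < min x (of_nat m)} \<subseteq> {l. 0 < l \<and> ennreal l < min x (of_nat (Suc m))}"
      by (auto elim: less_le_trans)
  qed
  moreover have "{l. 0 < l \<and> ennreal l < min x (of_nat m)} \<in> sets (stieltjes F)" for m
    by measurable
  ultimately show ?thesis
    unfolding ext_inf_eq_stieltjes[OF F] by (simp add: SUP_emeasure_incseq image_subset_iff)
qed

lemma ennreal_less_scaled_iff: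
  assumes "0 < c" "0 < l"
  shows "ennreal l < ennreal c * z \<longleftrightarrow> ennreal (l / c) < z"
  using assms
  by (cases z) (simp_all add: ennreal_mult[symmetric] ennreal_less_iff ennreal_mult_top pos_divide_less_eq mult.commute)

text \<open>The good-\<open>\<lambda>\<close> method of Burkholder and Gundy. The hypothesis gives
  \<open>P(X > 2l) \<le> \<epsilon> P(X > l) + P(T > \<delta>l)\<close>; integrating against \<open>dF(l)\<close> yields
  \<open>E F(X/2) \<le> \<epsilon> E F(X) + E F(T/\<delta>)\<close>, and growth of \<open>F\<close> replaces the left side by \<open>E F(X) / K\<close>. As
  \<open>K\<epsilon> \<le> 1/2\<close>, the term with \<open>X\<close> on the right can be absorbed provided that it is finite, so \<open>X\<close> is
  first truncated at a level \<open>m\<close>; truncation preserves the hypothesis, since \<open>min X m\<close> never exceeds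
  \<open>2l\<close> when \<open>2l \<ge> m\<close> and exceeds \<open>l\<close> exactly when \<open>X\<close> does otherwise.\<close>

lemma (in prob_space) good_lambda_moment_inequality:
  fixes X T :: "'a \<Rightarrow> ennreal"
  assumes F: "moderate F" and X[measurable]: "X \<in> borel_measurable M" and T[measurable]: "T \<in> borel_measurable M"
    and \<delta>: "0 < \<delta>" and K: "1 \<le> K" "\<And>x. 0 \<le> x \<Longrightarrow> F (2 * x) \<le> K * F x"
    and D: "1 \<le> D" "\<And>x. 0 \<le> x \<Longrightarrow> F (1 / \<delta> * x) \<le> D * F x"
    and \<epsilon>: "0 \<le> \<epsilon>" "K * \<epsilon> \<le> 1 / 2"
    and good: "\<And>l. 0 < l \<Longrightarrow>
      prob {\<omega>\<in>space M. ennreal (2 * l) < X \<omega> \<and> T \<omega> \<le> ennreal (\<delta> * l)}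
        \<le> \<epsilon> * prob {\<omega>\<in>space M. ennreal l < X \<omega>}"
  shows "(\<integral>\<^sup>+\<omega>. ext_inf F (X \<omega>) \<partial>M) \<le> ennreal (2 * K * D) * (\<integral>\<^sup>+\<omega>. ext_inf F (T \<omega>) \<partial>M)"
proof -
  note [measurable] = ext_inf_measurable[OF F]
  \<comment> \<open>A name for the factor \<open>1/2\<close>, since the simplifier rewrites the numeral inside \<open>ennreal\<close>.\<close>
  define \<kappa> where "\<kappa> = (1/2::real)"
  let ?R = "\<integral>\<^sup>+\<omega>. ext_inf F (T \<omega>) \<partial>M"
  have trunc: "(\<integral>\<^sup>+\<omega>. ext_inf F (min (X \<omega>) (of_nat m)) \<partial>M) \<le> ennreal (2 * K * D) * ?R" for m :: nat
  proof -
    define Z where "Z \<omega> = min (X \<omega>) (of_nat m)" for \<omega>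
    have [measurable]: "Z \<in> borel_measurable M" unfolding Z_def by measurable
    have le: "emeasure M {\<omega>\<in>space M. ennreal l < ennreal \<kappa> * Z \<omega>}
        \<le> ennreal \<epsilon> * emeasure M {\<omega>\<in>space M. ennreal l < Z \<omega>} + emeasure M {\<omega>\<in>space M. ennreal l < ennreal (1 / \<delta>) * T \<omega>}"
      (is "?a \<le> _") if l: "0 < l" for l
    proof -
      have half: "ennreal l < ennreal \<kappa> * z \<longleftrightarrow> ennreal (2 * l) < z" for z :: ennreal
        using ennreal_less_scaled_iff[of \<kappa> l z] l by (simp add: \<kappa>_def mult.commute)
      have del: "ennreal l < ennreal (1/\<delta>) * z \<longleftrightarrow> \<not> z \<le> ennreal (\<delta> * l)" for z :: ennreal
        using ennreal_less_scaled_iff[of "1/\<delta>" l z] l \<delta> by (simp add: mult.commute not_le)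
      let ?E = "{\<omega>\<in>space M. ennreal (2 * l) < Z \<omega> \<and> T \<omega> \<le> ennreal (\<delta> * l)}"
      have "prob ?E \<le> \<epsilon> * prob {\<omega>\<in>space M. ennreal l < Z \<omega>}"
      proof (cases "2 * l < real m")
        case True
        then have eq: "ennreal l < of_nat m" "ennreal (2 * l) < of_nat m"
          using l by (simp_all add: ennreal_of_nat_eq_real_of_nat ennreal_less_iff)
        then show ?thesis using good[OF l] by (simp add: Z_def)
      next
        case False
        then have "of_nat m \<le> ennreal (2 * l)" by (simp add: ennreal_of_nat_eq_real_of_nat)
        then have E: "?E = {}" by (auto simp: Z_def)
        show ?thesis unfolding E using \<epsilon> by simp
      qed
      then have E: "emeasure M ?E \<le> ennreal \<epsilon> * emeasure M {\<omega>\<in>space M. ennreal l < Z \<omega>}"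
        using \<epsilon> by (simp add: emeasure_eq_measure ennreal_mult[symmetric])
      have "?a \<le> emeasure M (?E \<union> {\<omega>\<in>space M. ennreal l < ennreal (1 / \<delta>) * T \<omega>})"
        unfolding half del by (intro emeasure_mono) auto
      also have "\<dots> \<le> emeasure M ?E + emeasure M {\<omega>\<in>space M. ennreal l < ennreal (1 / \<delta>) * T \<omega>}"
        by (intro emeasure_subadditive) auto
      finally show ?thesis using E by (meson add_right_mono order_trans)
    qed
    let ?A = "\<integral>\<^sup>+\<omega>. ext_inf F (Z \<omega>) \<partial>M"
    have "(\<integral>\<^sup>+\<omega>. ext_inf F (ennreal \<kappa> * Z \<omega>) \<partial>M)
        \<le> (\<integral>\<^sup>+l. ennreal \<epsilon> * (indicator {0<..} l * emeasure M {\<omega>\<in>space M. ennreal l < Z \<omega>})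
            + indicator {0<..} l * emeasure M {\<omega>\<in>space M. ennreal l < ennreal (1 / \<delta>) * T \<omega>} \<partial>stieltjes F)"
      by (subst nn_integral_ext_inf[OF F]) (auto intro!: nn_integral_mono le split: split_indicator)
    also have "\<dots> = ennreal \<epsilon> * ?A + (\<integral>\<^sup>+\<omega>. ext_inf F (ennreal (1/\<delta>) * T \<omega>) \<partial>M)"
      by (simp add: nn_integral_ext_inf[OF F] nn_integral_add nn_integral_cmult)
    also have "\<dots> \<le> ennreal \<epsilon> * ?A + ennreal D * ?R"
    proof (intro add_left_mono)
      have "(\<integral>\<^sup>+\<omega>. ext_inf F (ennreal (1/\<delta>) * T \<omega>) \<partial>M) \<le> (\<integral>\<^sup>+\<omega>. ennreal D * ext_inf F (T \<omega>) \<partial>M)"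
        using D \<delta> by (intro nn_integral_mono ext_inf_dilation F) auto
      then show "(\<integral>\<^sup>+\<omega>. ext_inf F (ennreal (1/\<delta>) * T \<omega>) \<partial>M) \<le> ennreal D * ?R"
        by (simp add: nn_integral_cmult)
    qed
    finally have half: "(\<integral>\<^sup>+\<omega>. ext_inf F (ennreal \<kappa> * Z \<omega>) \<partial>M) \<le> ennreal \<epsilon> * ?A + ennreal D * ?R" .
    have "ext_inf F (Z \<omega>) \<le> ennreal K * ext_inf F (ennreal \<kappa> * Z \<omega>)" for \<omega>
    proof -
      have "Z \<omega> = ennreal 2 * (ennreal \<kappa> * Z \<omega>)"
        by (simp add: mult.assoc[symmetric] ennreal_mult[symmetric] \<kappa>_def del: ennreal_numeral ennreal_half)
      then show ?thesis
        using ext_inf_dilation[OF F _ _ K(2), of "ennreal \<kappa> * Z \<omega>"] K by simp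
    qed
    then have "?A \<le> (\<integral>\<^sup>+\<omega>. ennreal K * ext_inf F (ennreal \<kappa> * Z \<omega>) \<partial>M)"
      by (intro nn_integral_mono)
    also have "\<dots> = ennreal K * (\<integral>\<^sup>+\<omega>. ext_inf F (ennreal \<kappa> * Z \<omega>) \<partial>M)"
      by (simp add: nn_integral_cmult)
    also have "\<dots> \<le> ennreal K * (ennreal \<epsilon> * ?A + ennreal D * ?R)"
      by (intro mult_left_mono half) simp
    finally have main: "?A \<le> ennreal K * (ennreal \<epsilon> * ?A + ennreal D * ?R)" .
    have "?A \<le> (\<integral>\<^sup>+\<omega>. ennreal (F (real m)) \<partial>M)"
    proof (intro nn_integral_mono)
      fix \<omega>
      have "ext_inf F (Z \<omega>) \<le> ext_inf F (of_nat m)" by (intro ext_inf_mono F) (simp add: Z_def)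
      then show "ext_inf F (Z \<omega>) \<le> ennreal (F (real m))"
        by (simp add: ext_inf_def ennreal_of_nat_eq_real_of_nat)
    qed
    also have "\<dots> = ennreal (F (real m))" by (simp add: emeasure_space_1)
    finally have "?A < \<infinity>" using le_less_trans by fastforce
    then obtain a where a: "?A = ennreal a" "0 \<le> a" by (cases ?A) auto
    show ?thesis
    proof (cases ?R)
      case top
      then show ?thesis using K D by (simp add: ennreal_mult_top)
    next
      case (real r)
      have "a \<le> K * (\<epsilon> * a + D * r)"
        using main K D \<epsilon> a real
        by (simp add: ennreal_mult[symmetric] ennreal_plus[symmetric] del: ennreal_plus)
      also have "\<dots> = (K * \<epsilon>) * a + K * D * r" by (simp add: algebra_simps)
      also have "(K * \<epsilon>) * a \<le> 1/2 * a" using \<epsilon> a by (intro mult_right_mono)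
      finally have "a \<le> 2 * K * D * r" by simp
      then show ?thesis
        using a K D unfolding Z_def[symmetric] real
        by (simp add: ennreal_mult[symmetric] real)
    qed
  qed
  have "(\<integral>\<^sup>+\<omega>. ext_inf F (X \<omega>) \<partial>M) = (\<integral>\<^sup>+\<omega>. (SUP m. ext_inf F (min (X \<omega>) (of_nat m))) \<partial>M)"
    by (simp add: ext_inf_SUP_min[OF F, symmetric])
  also have "\<dots> = (SUP m. \<integral>\<^sup>+\<omega>. ext_inf F (min (X \<omega>) (of_nat m)) \<partial>M)"
    by (intro nn_integral_monotone_convergence_SUP incseq_SucI le_funI ext_inf_mono F min.mono order_refl of_nat_mono)
       auto
  also have "\<dots> \<le> ennreal (2 * K * D) * ?R" by (intro SUP_least trunc)
  finally show ?thesis .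
qed

section \<open>Continuous paths and martingale transforms of Brownian motion\<close>

text \<open>Suprema and infima over real times are reduced to countably many times, which keeps them measurable.
  Approximating from below never leaves a time interval \<open>[0,t]\<close>.\<close>

lemma rational_approx_from_below:
  fixes s :: real
  assumes "0 \<le> s"
  obtains q where "\<And>k. q k \<in> \<rat>" "\<And>k. 0 \<le> q k" "\<And>k. q k \<le> s" "q \<longlonglongrightarrow> s"
proof -
  define q :: "nat \<Rightarrow> real" where "q k = \<lfloor>s * Suc k\<rfloor> / Suc k" for k
  have up: "q k \<le> s" for k
    using of_int_floor_le[of "s * Suc k"] unfolding q_def by (simp add: divide_le_eq)
  have lo: "s - inverse (real (Suc k)) \<le> q k" for k
  proof -
    have "s * Suc k - 1 \<le> \<lfloor>s * Suc k\<rfloor>" by linarith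
    then have "(s * Suc k - 1) / Suc k \<le> q k" unfolding q_def by (intro divide_right_mono) auto
    moreover have "(s * Suc k - 1) / Suc k = s - inverse (real (Suc k))"
      by (simp add: diff_divide_distrib inverse_eq_divide del: of_nat_Suc)
    ultimately show ?thesis by simp
  qed
  have "(\<lambda>k. s - inverse (real (Suc k))) \<longlonglongrightarrow> s - 0"
    by (intro tendsto_intros LIMSEQ_inverse_real_of_nat)
  then have "q \<longlonglongrightarrow> s"
    by (intro tendsto_sandwich[of "\<lambda>k. s - inverse (real (Suc k))" q sequentially "\<lambda>_. s" s])
       (use up lo in \<open>auto intro!: always_eventually\<close>)
  moreover have "q k \<in> \<rat>" "0 \<le> q k" for k using assms by (simp_all add: q_def)
  ultimately show ?thesis using up that by blast
qed

lemma continuous_rational_witness: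
  fixes f :: "real \<Rightarrow> real"
  assumes "continuous_on {0..} f" "0 \<le> s" "open O'" "f s \<in> O'"
  shows "\<exists>q\<in>\<rat>. 0 \<le> q \<and> q \<le> s \<and> f q \<in> O'"
proof -
  obtain q where q: "\<And>k. q k \<in> \<rat>" "\<And>k. 0 \<le> q k" "\<And>k. q k \<le> s" "q \<longlonglongrightarrow> s"
    using rational_approx_from_below[OF assms(2)] by blast
  have "(\<lambda>k. f (q k)) \<longlonglongrightarrow> f s"
    using q assms(2) by (intro continuous_on_tendsto_compose[OF assms(1) q(4)]) (auto intro: always_eventually)
  then have "\<forall>\<^sub>F k in sequentially. f (q k) \<in> O'"
    using assms(3,4) by (simp add: topological_tendstoD)
  then obtain k where "f (q k) \<in> O'" by (auto simp: eventually_sequentially)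
  then show ?thesis using q by blast
qed

text \<open>Almost every path is uniformly continuous on \<open>[0,T]\<close>, so the events that the modulus of
  continuity at scale \<open>1/n\<close> exceeds \<open>\<eta>\<close> decrease to a null set. Rational times make these events
  measurable; half of the scale leaves room for passing back to real times.\<close>

lemma (in prob_space) small_oscillation_with_high_probability:
  fixes X :: "real \<Rightarrow> 'a \<Rightarrow> real"
  assumes meas: "\<And>t. 0 \<le> t \<Longrightarrow> X t \<in> borel_measurable M"
    and cont: "AE \<omega> in M. continuous_on {0..} (\<lambda>t. X t \<omega>)"
    and \<epsilon>: "0 < \<epsilon>" and \<eta>: "0 < \<eta>"
  shows "\<exists>h>0. \<exists>N\<in>events. prob N < \<epsilon> \<and>
    (AE \<omega> in M. \<omega> \<notin> N \<longrightarrow> (\<forall>s\<in>{0..T}. \<forall>t\<in>{0..T}. \<bar>s - t\<bar> \<le> h \<longrightarrow> \<bar>X s \<omega> - X t \<omega>\<bar> \<le> \<eta>))"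
proof -
  let ?D = "\<rat> \<inter> {0..T}"
  define N where "N n = (\<Union>s\<in>?D. \<Union>t\<in>?D. {\<omega>\<in>space M. \<bar>s - t\<bar> < inverse (real (Suc n)) \<and> \<eta> < \<bar>X s \<omega> - X t \<omega>\<bar>})" for n
  have D: "countable ?D" using countable_rat by blast
  have N_sets: "N n \<in> events" for n
    unfolding N_def
  proof (intro sets.countable_UN''[OF D])
    fix s t assume "s \<in> ?D" "t \<in> ?D"
    then have [measurable]: "X s \<in> borel_measurable M" "X t \<in> borel_measurable M" using meas by auto
    show "{\<omega>\<in>space M. \<bar>s - t\<bar> < inverse (real (Suc n)) \<and> \<eta> < \<bar>X s \<omega> - X t \<omega>\<bar>} \<in> events" by measurable
  qed
  have dec: "decseq N"
  proof (intro decseq_SucI subsetI)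
    fix n \<omega> assume "\<omega> \<in> N (Suc n)"
    then obtain s t where st: "s \<in> ?D" "t \<in> ?D" "\<omega> \<in> space M"
        "\<bar>s - t\<bar> < inverse (real (Suc (Suc n)))" "\<eta> < \<bar>X s \<omega> - X t \<omega>\<bar>"
      unfolding N_def by blast
    have "inverse (real (Suc (Suc n))) \<le> inverse (real (Suc n))" by (intro le_imp_inverse_le) auto
    then have "\<bar>s - t\<bar> < inverse (real (Suc n))" using st(4) by linarith
    then show "\<omega> \<in> N n" unfolding N_def using st by blast
  qed
  have "AE \<omega> in M. \<omega> \<notin> (\<Inter>n. N n)"
    using cont
  proof eventually_elim
    case c: (elim \<omega>)
    show ?case
    proof
      assume \<omega>: "\<omega> \<in> (\<Inter>n. N n)"
      have "uniformly_continuous_on {0..T} (\<lambda>t. X t \<omega>)"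
        by (intro compact_uniformly_continuous continuous_on_subset[OF c]) auto
      then obtain d where d: "d > 0" "\<And>s t. s \<in> {0..T} \<Longrightarrow> t \<in> {0..T} \<Longrightarrow> dist s t < d \<Longrightarrow> dist (X s \<omega>) (X t \<omega>) < \<eta>"
        using \<eta> unfolding uniformly_continuous_on_def by metis
      obtain n where n: "inverse (real (Suc n)) < d" using reals_Archimedean[OF d(1)] by blast
      from \<omega> have "\<omega> \<in> N n" by blast
      then obtain s t where st: "s \<in> {0..T}" "t \<in> {0..T}" "\<bar>s - t\<bar> < inverse (real (Suc n))" "\<eta> < \<bar>X s \<omega> - X t \<omega>\<bar>"
        unfolding N_def by blast
      then have "dist s t < d" using n by (simp add: dist_real_def)
      from d(2)[OF st(1,2) this] st(4) show False by (simp add: dist_real_def)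
    qed
  qed
  then have "prob (\<Inter>n. N n) = 0" using N_sets by (subst prob_eq_0) auto
  moreover have "(\<lambda>n. prob (N n)) \<longlonglongrightarrow> prob (\<Inter>n. N n)"
    using N_sets dec by (intro finite_Lim_measure_decseq) auto
  ultimately have "\<forall>\<^sub>F n in sequentially. prob (N n) < \<epsilon>"
    using \<epsilon> order_tendstoD(2) by metis
  then obtain n where n: "prob (N n) < \<epsilon>" by (auto simp: eventually_sequentially)
  have "AE \<omega> in M. \<omega> \<notin> N n \<longrightarrow> (\<forall>s\<in>{0..T}. \<forall>t\<in>{0..T}. \<bar>s - t\<bar> \<le> inverse (real (Suc n)) / 2 \<longrightarrow> \<bar>X s \<omega> - X t \<omega>\<bar> \<le> \<eta>)"
    using cont AE_space
  proof eventually_elim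
    case (elim \<omega>)
    show ?case
    proof (intro impI ballI)
      fix s t assume "\<omega> \<notin> N n" and s: "s \<in> {0..T}" and t: "t \<in> {0..T}" and st: "\<bar>s - t\<bar> \<le> inverse (real (Suc n)) / 2"
      from elim have c: "continuous_on {0..} (\<lambda>t. X t \<omega>)" by simp
      have \<omega>: "\<omega> \<notin> N n" "\<omega> \<in> space M" by fact (use elim in simp)
      have "0 \<le> s" "0 \<le> t" using s t by auto
      obtain q where q: "\<And>k. q k \<in> \<rat>" "\<And>k. 0 \<le> q k" "\<And>k. q k \<le> s" "q \<longlonglongrightarrow> s"
        using rational_approx_from_below[OF \<open>0 \<le> s\<close>] by blast
      obtain r where r: "\<And>k. r k \<in> \<rat>" "\<And>k. 0 \<le> r k" "\<And>k. r k \<le> t" "r \<longlonglongrightarrow> t"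
        using rational_approx_from_below[OF \<open>0 \<le> t\<close>] by blast
      have pos: "0 < inverse (real (Suc n))" by (intro positive_imp_inverse_positive) simp
      have "(\<lambda>k. \<bar>q k - r k\<bar>) \<longlonglongrightarrow> \<bar>s - t\<bar>" by (intro tendsto_intros q r)
      moreover have "\<bar>s - t\<bar> < inverse (real (Suc n))" using st pos by linarith
      ultimately have ev: "\<forall>\<^sub>F k in sequentially. \<bar>q k - r k\<bar> < inverse (real (Suc n))"
        by (rule order_tendstoD(2))
      have "(\<lambda>k. X (q k) \<omega>) \<longlonglongrightarrow> X s \<omega>"
        using q \<open>0 \<le> s\<close> by (intro continuous_on_tendsto_compose[OF c q(4)]) (auto intro: always_eventually)
      moreover have "(\<lambda>k. X (r k) \<omega>) \<longlonglongrightarrow> X t \<omega>"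
        using r \<open>0 \<le> t\<close> by (intro continuous_on_tendsto_compose[OF c r(4)]) (auto intro: always_eventually)
      ultimately have lim: "(\<lambda>k. \<bar>X (q k) \<omega> - X (r k) \<omega>\<bar>) \<longlonglongrightarrow> \<bar>X s \<omega> - X t \<omega>\<bar>"
        by (intro tendsto_intros)
      show "\<bar>X s \<omega> - X t \<omega>\<bar> \<le> \<eta>"
      proof (rule tendsto_upperbound[OF lim _ sequentially_bot])
        show "\<forall>\<^sub>F k in sequentially. \<bar>X (q k) \<omega> - X (r k) \<omega>\<bar> \<le> \<eta>"
          using ev
        proof eventually_elim
          fix k assume k: "\<bar>q k - r k\<bar> < inverse (real (Suc n))"
          have "q k \<in> ?D" "r k \<in> ?D" using q(1-3)[of k] r(1-3)[of k] s t by auto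
          then show "\<bar>X (q k) \<omega> - X (r k) \<omega>\<bar> \<le> \<eta>"
            using \<omega> k unfolding N_def not_less[symmetric] by blast
        qed
      qed
    qed
  qed
  moreover have "inverse (real (Suc n)) / 2 > 0" by simp
  ultimately show ?thesis using n N_sets by blast
qed

context usual_filtered_space
begin

lemma subalgebra_Ft: "s \<le> t \<Longrightarrow> subalgebra (Ft t) (Ft s)"
  by (simp add: subalgebra_def space_F sets_F_mono)

lemma measurable_Ft_mono: "f \<in> borel_measurable (Ft s) \<Longrightarrow> s \<le> t \<Longrightarrow> f \<in> borel_measurable (Ft t)"
  using measurable_from_subalg[OF subalgebra_Ft] .

lemma measurable_Ft_M: "f \<in> borel_measurable (Ft s) \<Longrightarrow> f \<in> borel_measurable M"
  using measurable_from_subalg[OF sub_M] .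

text \<open>Independence of \<open>\<sigma>\<close>-algebras, as in the definition of Brownian motion, in the form that the
  product rule for expectations uses.\<close>

lemma brownian_increment_indep:
  assumes bm: "brownian_motion M Ft B" and st: "0 \<le> s" "s < t" and g: "g \<in> borel_measurable (Ft (ennreal s))"
  shows "indep_var borel g borel (\<lambda>\<omega>. B t \<omega> - B s \<omega>)"
proof -
  let ?d = "\<lambda>\<omega>. B t \<omega> - B s \<omega>"
  have ind: "indep_set (sets (Ft (ennreal s))) {?d -` A \<inter> space M | A. A \<in> sets borel}"
    and dist: "distributed M lborel ?d (\<lambda>x. ennreal (normal_density 0 (sqrt (t - s)) x))"
    using bm st unfolding brownian_motion_def by blast+
  have "sigma_sets (space M) {g -` A \<inter> space M | A. A \<in> sets borel} \<subseteq> sets (Ft (ennreal s))"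
  proof -
    have "{g -` A \<inter> space M | A. A \<in> sets borel} \<subseteq> sets (Ft (ennreal s))"
      using measurable_sets[OF g] by (auto simp: space_F)
    then show ?thesis using sets.sigma_sets_subset[of _ "Ft (ennreal s)"] by (simp add: space_F)
  qed
  moreover have "sigma_sets (space M) {?d -` A \<inter> space M | A. A \<in> sets borel} \<subseteq> {?d -` A \<inter> space M | A. A \<in> sets borel}"
    unfolding sets_vimage_algebra[symmetric] by (subst sets_vimage_algebra2) auto
  ultimately have "indep_set (sigma_sets (space M) {g -` A \<inter> space M | A. A \<in> sets borel})
      (sigma_sets (space M) {?d -` A \<inter> space M | A. A \<in> sets borel})"
    using ind unfolding indep_set_def
    by (elim indep_sets_mono_sets) (auto split: bool.split)
  moreover have "?d \<in> borel_measurable M" using distributed_measurable[OF dist] by simp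
  ultimately show ?thesis
    using measurable_Ft_M[OF g] by (simp add: indep_var_eq)
qed

lemma brownian_increment_moments:
  assumes bm: "brownian_motion M Ft B" and st: "0 \<le> s" "s < t"
  shows "integrable M (\<lambda>\<omega>. B t \<omega> - B s \<omega>)" "expectation (\<lambda>\<omega>. B t \<omega> - B s \<omega>) = 0"
    "integrable M (\<lambda>\<omega>. (B t \<omega> - B s \<omega>)\<^sup>2)" "expectation (\<lambda>\<omega>. (B t \<omega> - B s \<omega>)\<^sup>2) = t - s"
proof -
  let ?d = "\<lambda>\<omega>. B t \<omega> - B s \<omega>"
  have dist: "distributed M lborel ?d (\<lambda>x. ennreal (normal_density 0 (sqrt (t - s)) x))"
    using bm st unfolding brownian_motion_def by blast
  have pos: "0 < sqrt (t - s)" using st by simp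
  have mom: "integrable M (\<lambda>\<omega>. ?d \<omega> ^ k)" for k
    using distributed_integrable[OF dist, of "\<lambda>x. x ^ k"] integrable_normal_moment[OF pos, of 0 k] by simp
  from mom[of 1] show "integrable M ?d" by simp
  from mom[of 2] show "integrable M (\<lambda>\<omega>. (?d \<omega>)\<^sup>2)" by simp
  show m: "expectation ?d = 0" by (rule normal_distributed_expectation[OF pos dist])
  show "expectation (\<lambda>\<omega>. (?d \<omega>)\<^sup>2) = t - s"
    using normal_distributed_variance[OF pos dist] st unfolding m by simp
qed

text \<open>The discrete Ito isometry. Cross terms vanish because \<open>S n * \<zeta> n\<close> is known at time \<open>t n\<close> and the next
  increment is centred and independent of that past; the diagonal terms factor for the same reason.
  Equal consecutive times are permitted because a finite grid is enumerated by an eventually constant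
  sequence.\<close>

lemma martingale_transform_isometry:
  fixes t :: "nat \<Rightarrow> real" and \<zeta> :: "nat \<Rightarrow> 'a \<Rightarrow> real"
  assumes bm: "brownian_motion M Ft B" and t0: "\<And>j. 0 \<le> t j" and tm: "\<And>j. t j \<le> t (Suc j)"
    and meas: "\<And>j. \<zeta> j \<in> borel_measurable (Ft (ennreal (t j)))"
    and bdd: "\<And>j \<omega>. \<omega> \<in> space M \<Longrightarrow> \<bar>\<zeta> j \<omega>\<bar> \<le> K j"
  defines "S \<equiv> \<lambda>n \<omega>. \<Sum>j<n. \<zeta> j \<omega> * (B (t (Suc j)) \<omega> - B (t j) \<omega>)"
  shows "S n \<in> borel_measurable (Ft (ennreal (t n))) \<and> integrable M (\<lambda>\<omega>. (S n \<omega>)\<^sup>2) \<and>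
    expectation (\<lambda>\<omega>. (S n \<omega>)\<^sup>2) = (\<Sum>j<n. expectation (\<lambda>\<omega>. (\<zeta> j \<omega>)\<^sup>2) * (t (Suc j) - t j))"
proof (induction n)
  case 0
  then show ?case by (simp add: S_def)
next
  case (Suc n)
  let ?d = "\<lambda>\<omega>. B (t (Suc n)) \<omega> - B (t n) \<omega>"
  have S_Suc: "S (Suc n) \<omega> = S n \<omega> + \<zeta> n \<omega> * ?d \<omega>" for \<omega> by (simp add: S_def)
  have Bm: "B (t j) \<in> borel_measurable (Ft (ennreal (t j)))" for j
    using bm t0 unfolding brownian_motion_def continuous_adapted_def adapted_def by blast
  have le: "ennreal (t n) \<le> ennreal (t (Suc n))" using tm by (intro ennreal_leI)
  have Sm: "S n \<in> borel_measurable (Ft (ennreal (t n)))" and S2: "integrable M (\<lambda>\<omega>. (S n \<omega>)\<^sup>2)"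
    using Suc by auto
  have [measurable]: "S n \<in> borel_measurable M" "\<zeta> n \<in> borel_measurable M"
    using measurable_Ft_M Sm meas by blast+
  have 1: "S (Suc n) \<in> borel_measurable (Ft (ennreal (t (Suc n))))"
  proof -
    have [measurable]: "S n \<in> borel_measurable (Ft (ennreal (t (Suc n))))" "\<zeta> n \<in> borel_measurable (Ft (ennreal (t (Suc n))))"
      "B (t n) \<in> borel_measurable (Ft (ennreal (t (Suc n))))" "B (t (Suc n)) \<in> borel_measurable (Ft (ennreal (t (Suc n))))"
      using measurable_Ft_mono[OF _ le] Sm meas Bm by blast+
    show ?thesis unfolding S_Suc[abs_def] by measurable
  qed
  show ?case
  proof (cases "t n = t (Suc n)")
    case True
    then have "S (Suc n) = S n" by (simp add: S_Suc fun_eq_iff)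
    then show ?thesis using Suc 1 True by simp
  next
    case False
    then have lt: "t n < t (Suc n)" using tm[of n] by simp
    note mom = brownian_increment_moments[OF bm t0 lt]
    note ind = brownian_increment_indep[OF bm t0 lt]
    have Si: "integrable M (S n)" by (rule square_integrable_imp_integrable[OF _ S2]) measurable
    have g: "integrable M (\<lambda>\<omega>. S n \<omega> * \<zeta> n \<omega>)"
    proof (rule Bochner_Integration.integrable_bound)
      show "integrable M (\<lambda>\<omega>. K n * S n \<omega>)" using Si by simp
      show "AE \<omega> in M. norm (S n \<omega> * \<zeta> n \<omega>) \<le> norm (K n * S n \<omega>)"
      proof (rule AE_I2)
        fix \<omega> assume "\<omega> \<in> space M"
        then have "\<bar>\<zeta> n \<omega>\<bar> \<le> \<bar>K n\<bar>" using bdd[of \<omega> n] by linarith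
        then have "\<bar>S n \<omega>\<bar> * \<bar>\<zeta> n \<omega>\<bar> \<le> \<bar>S n \<omega>\<bar> * \<bar>K n\<bar>" by (intro mult_left_mono) auto
        then show "norm (S n \<omega> * \<zeta> n \<omega>) \<le> norm (K n * S n \<omega>)" by (simp add: abs_mult mult.commute)
      qed
    qed simp
    have z: "integrable M (\<lambda>\<omega>. (\<zeta> n \<omega>)\<^sup>2)"
    proof (rule integrable_const_bound[of _ "(K n)\<^sup>2"])
      show "AE \<omega> in M. norm ((\<zeta> n \<omega>)\<^sup>2) \<le> (K n)\<^sup>2"
      proof (rule AE_I2)
        fix \<omega> assume "\<omega> \<in> space M"
        from power_mono[OF bdd[OF this, of n], of 2] show "norm ((\<zeta> n \<omega>)\<^sup>2) \<le> (K n)\<^sup>2" by simp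
      qed
    qed simp
    have gd: "indep_var borel (\<lambda>\<omega>. S n \<omega> * \<zeta> n \<omega>) borel ?d"
      by (intro ind borel_measurable_times Sm meas)
    have "indep_var borel ((\<lambda>x. x\<^sup>2) \<circ> \<zeta> n) borel ((\<lambda>x. x\<^sup>2) \<circ> ?d)"
      by (intro indep_var_compose[OF ind] meas) auto
    then have zd: "indep_var borel (\<lambda>\<omega>. (\<zeta> n \<omega>)\<^sup>2) borel (\<lambda>\<omega>. (?d \<omega>)\<^sup>2)"
      by (simp add: comp_def)
    have eq: "(S (Suc n) \<omega>)\<^sup>2 = (S n \<omega>)\<^sup>2 + (2 * ((S n \<omega> * \<zeta> n \<omega>) * ?d \<omega>) + (\<zeta> n \<omega>)\<^sup>2 * (?d \<omega>)\<^sup>2)" for \<omega>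
      unfolding S_Suc by (simp add: power2_eq_square algebra_simps)
    have i1: "integrable M (\<lambda>\<omega>. (S n \<omega> * \<zeta> n \<omega>) * ?d \<omega>)"
      by (rule indep_var_integrable[OF gd g mom(1)])
    have e1: "expectation (\<lambda>\<omega>. (S n \<omega> * \<zeta> n \<omega>) * ?d \<omega>) = 0"
      using indep_var_lebesgue_integral[OF gd g mom(1)] mom(2) by simp
    have i2: "integrable M (\<lambda>\<omega>. (\<zeta> n \<omega>)\<^sup>2 * (?d \<omega>)\<^sup>2)"
      by (rule indep_var_integrable[OF zd z mom(3)])
    have e2: "expectation (\<lambda>\<omega>. (\<zeta> n \<omega>)\<^sup>2 * (?d \<omega>)\<^sup>2) = expectation (\<lambda>\<omega>. (\<zeta> n \<omega>)\<^sup>2) * (t (Suc n) - t n)"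
      using indep_var_lebesgue_integral[OF zd z mom(3)] mom(4) by simp
    have "integrable M (\<lambda>\<omega>. (S (Suc n) \<omega>)\<^sup>2)"
      unfolding eq by (intro Bochner_Integration.integrable_add integrable_mult_right S2 i1 i2)
    moreover have "expectation (\<lambda>\<omega>. (S (Suc n) \<omega>)\<^sup>2) = (\<Sum>j<Suc n. expectation (\<lambda>\<omega>. (\<zeta> j \<omega>)\<^sup>2) * (t (Suc j) - t j))"
      unfolding eq using S2 i1 i2 Suc by (simp add: e1 e2)
    ultimately show ?thesis using 1 by blast
  qed
qed

end

section \<open>Simple processes on a refining grid\<close>

text \<open>A nonnegative sum that adds a term only while the total including that term is within the budget
  never exceeds the budget. For stopped integrals this is a predictable substitute for the first time
  at which the quadratic variation reaches a level.\<close>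

lemma sum_until_budget_le:
  fixes a :: "nat \<Rightarrow> real"
  assumes a: "\<And>i. 0 \<le> a i" and q: "0 \<le> q"
  shows "(\<Sum>j<n. if P j \<and> (\<Sum>i\<le>j. a i) \<le> q then a j else 0) \<le> q"
proof (induction n)
  case (Suc n)
  let ?b = "\<lambda>j. if P j \<and> (\<Sum>i\<le>j. a i) \<le> q then a j else 0"
  show ?case
  proof (cases "P n \<and> (\<Sum>i\<le>n. a i) \<le> q")
    case True
    have "(\<Sum>j<Suc n. ?b j) \<le> (\<Sum>j<Suc n. a j)" using a by (intro sum_mono) auto
    also have "\<dots> \<le> q" using True by (simp add: lessThan_Suc_atMost)
    finally show ?thesis .
  next
    case False
    then show ?thesis using Suc by auto
  qed
qed (simp add: q)

text \<open>A simple process is constant on the cells of a grid that contains its endpoints \<open>D\<close>, while a small mesh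
  \<open>h\<close> makes stopping times close to grid times. Grid points of \<open>D\<close> may lie beyond \<open>L\<close>.\<close>

lemma refining_grid_exists:
  fixes D :: "real set"
  assumes D: "finite D" "D \<subseteq> {0..}" and h: "0 < h"
  obtains t :: "nat \<Rightarrow> real" and n :: nat where "mono t" "\<And>j. 0 \<le> t j"
    "\<And>d i. d \<in> D \<Longrightarrow> d \<le> t i \<or> t (Suc i) \<le> d"
    "\<And>x. 0 \<le> x \<Longrightarrow> x \<le> L \<Longrightarrow> \<exists>j\<le>n. x \<le> t j \<and> t j \<le> x + h"
proof -
  define E where "E = D \<union> (\<lambda>k. real k * h) ` {..nat \<lceil>L / h\<rceil>}"
  define xs where "xs = sorted_list_of_set E"
  have E: "finite E" "E \<subseteq> {0..}" "E \<noteq> {}" using D h by (auto simp: E_def)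
  have set_xs: "set xs = E" and sorted: "sorted xs" and ne: "xs \<noteq> []"
    using E by (simp_all add: xs_def)
  define t where "t j = xs ! min j (length xs - 1)" for j
  have in_E: "t j \<in> E" for j
    unfolding set_xs[symmetric] t_def using ne by (intro nth_mem) (auto simp: min_less_iff_disj)
  have mono: "mono t"
    unfolding t_def using ne by (intro monoI sorted_nth_mono[OF sorted]) (auto simp: min_less_iff_disj)
  have surj: "\<exists>j\<le>length xs. t j = d" if "d \<in> E" for d
  proof -
    from that obtain j where "j < length xs" "xs ! j = d"
      unfolding set_xs[symmetric] by (auto simp: in_set_conv_nth)
    then show ?thesis by (intro exI[of _ j]) (auto simp: t_def min_def)
  qed
  show ?thesis
  proof
    show "mono t" by (fact mono)
    show "0 \<le> t j" for j using in_E[of j] E by auto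
    show "d \<le> t i \<or> t (Suc i) \<le> d" if "d \<in> D" for d i
    proof -
      have "d \<in> E" using that by (simp add: E_def)
      then obtain m where m: "t m = d" using surj by blast
      show ?thesis
      proof (cases "m \<le> i")
        case True
        then show ?thesis using monoD[OF mono True] m by simp
      next
        case False
        then show ?thesis using monoD[OF mono, of "Suc i" m] m by simp
      qed
    qed
    show "\<exists>j\<le>length xs. x \<le> t j \<and> t j \<le> x + h" if x: "0 \<le> x" "x \<le> L" for x
    proof -
      define k where "k = nat \<lceil>x / h\<rceil>"
      have "k \<le> nat \<lceil>L / h\<rceil>" using x h unfolding k_def by (intro nat_mono ceiling_mono divide_right_mono) auto
      then have "real k * h \<in> E" by (auto simp: E_def)
      then obtain j where j: "j \<le> length xs" "t j = real k * h" using surj by blast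
      have "0 \<le> x / h" using x h by simp
      then have "x / h \<le> real k" "real k \<le> x / h + 1" unfolding k_def by linarith+
      then have "x \<le> real k * h" "real k * h \<le> x + h" using h by (auto simp: field_simps)
      then show ?thesis using j by auto
    qed
  qed
qed

text \<open>The first grid times \<open>t p\<close> after \<open>s\<close> and \<open>t r\<close> after \<open>u\<close>: rounding up keeps the rounded times stopping
  times, and a cell is used exactly when its left end point lies in \<open>[s,u)\<close>.\<close>

lemma grid_indices_between:
  fixes t :: "nat \<Rightarrow> real"
  assumes t: "mono t" and su: "s \<le> u"
    and s: "\<exists>j\<le>n. s \<le> t j \<and> t j \<le> s + h" and u: "\<exists>j\<le>n. u \<le> t j \<and> t j \<le> u + h"
  obtains p r where "p \<le> r" "r \<le> n" "s \<le> t p" "t p \<le> s + h" "u \<le> t r" "t r \<le> u + h"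
    "\<And>j. (s \<le> t j \<and> t j < u) \<longleftrightarrow> j \<in> {p..<r}"
proof -
  define p where "p = (LEAST j. s \<le> t j)"
  define r where "r = (LEAST j. u \<le> t j)"
  from s obtain js where js: "js \<le> n" "s \<le> t js" "t js \<le> s + h" by blast
  from u obtain ju where ju: "ju \<le> n" "u \<le> t ju" "t ju \<le> u + h" by blast
  have p: "s \<le> t p" "p \<le> js" unfolding p_def using js by (auto intro: LeastI Least_le)
  have r: "u \<le> t r" "r \<le> ju" unfolding r_def using ju by (auto intro: LeastI Least_le)
  have pr: "p \<le> r" unfolding p_def using r su by (intro Least_le) simp
  have "(s \<le> t j \<and> t j < u) \<longleftrightarrow> j \<in> {p..<r}" for j
  proof
    assume j: "s \<le> t j \<and> t j < u"
    then have "p \<le> j" unfolding p_def by (intro Least_le) simp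
    moreover have "j < r"
    proof (rule ccontr)
      assume "\<not> j < r"
      then have "t r \<le> t j" by (intro monoD[OF t]) simp
      then show False using r j by simp
    qed
    ultimately show "j \<in> {p..<r}" by simp
  next
    assume j: "j \<in> {p..<r}"
    then have "t p \<le> t j" by (intro monoD[OF t]) simp
    moreover have "\<not> u \<le> t j" using j unfolding r_def by (intro not_less_Least) simp
    ultimately show "s \<le> t j \<and> t j < u" using p by simp
  qed
  moreover have "t p \<le> s + h" "t r \<le> u + h"
    using monoD[OF t p(2)] monoD[OF t r(2)] js ju by simp_all
  moreover have "r \<le> n" using r ju by simp
  ultimately show ?thesis using that p r pr by blast
qed

lemma sum_indicator_cells:
  fixes t :: "nat \<Rightarrow> real"
  assumes "mono t" "p \<le> r"
  shows "(\<Sum>i\<in>{p..<r}. indicator {t i<..t (Suc i)} s) = (indicator {t p<..t r} s :: ennreal)"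
  using assms(2)
proof (induction rule: dec_induct)
  case (step n)
  have "t p \<le> t n" "t n \<le> t (Suc n)" using step by (auto intro: monoD[OF assms(1)])
  then show ?case using step by (auto simp: indicator_def)
qed simp

text \<open>On \<open>(t p, t r]\<close> the energy of the step function \<open>J\<close> is compared with that of \<open>H\<close> by
  \<open>J\<^sup>2 \<le> 2 H\<^sup>2 + 2 (J - H)\<^sup>2\<close>. The factor 2 only affects constants.\<close>

lemma step_function_energy_le:
  fixes H J :: "real \<Rightarrow> real" and t :: "nat \<Rightarrow> real"
  assumes t: "mono t" and pr: "p \<le> r" and t0: "0 \<le> t p" and tL: "t r \<le> L"
    and step: "\<And>i s. s \<in> {t i<..t (Suc i)} \<Longrightarrow> J s = J (t (Suc i))"
    and J: "J \<in> borel_measurable borel" and H: "continuous_on {0..} H"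
    and bound: "\<And>s. s \<in> {t p<..t r} \<Longrightarrow> (H s)\<^sup>2 \<le> k" and k: "0 \<le> k"
    and close: "(\<integral>\<^sup>+s\<in>{0..L}. ennreal ((J s - H s)\<^sup>2) \<partial>lborel) \<le> ennreal \<eta>" and \<eta>: "0 \<le> \<eta>"
  shows "(\<Sum>i\<in>{p..<r}. (J (t (Suc i)))\<^sup>2 * (t (Suc i) - t i)) \<le> 2 * k * (t r - t p) + 2 * \<eta>"
proof -
  define H' where "H' s = indicator {0..} s *\<^sub>R H s" for s
  have [measurable]: "H' \<in> borel_measurable borel"
    unfolding H'_def by (intro borel_measurable_continuous_on_indicator H) simp
  note J[measurable]
  have tm: "t i \<le> t (Suc i)" for i by (intro monoD[OF t]) simp
  have tpr: "t p \<le> t r" by (intro monoD[OF t] pr)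
  have "ennreal (\<Sum>i\<in>{p..<r}. (J (t (Suc i)))\<^sup>2 * (t (Suc i) - t i))
      = (\<Sum>i\<in>{p..<r}. \<integral>\<^sup>+s. ennreal ((J (t (Suc i)))\<^sup>2) * indicator {t i<..t (Suc i)} s \<partial>lborel)"
    using tm by (simp add: sum_ennreal[symmetric] ennreal_mult nn_integral_cmult_indicator)
  also have "\<dots> = (\<integral>\<^sup>+s. (\<Sum>i\<in>{p..<r}. ennreal ((J (t (Suc i)))\<^sup>2) * indicator {t i<..t (Suc i)} s) \<partial>lborel)"
    by (intro nn_integral_sum[symmetric]) simp
  also have "\<dots> \<le> (\<integral>\<^sup>+s. ennreal (2 * k) * indicator {t p<..t r} s
      + ennreal 2 * (ennreal ((J s - H' s)\<^sup>2) * indicator {0..L} s) \<partial>lborel)"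
  proof (intro nn_integral_mono)
    fix s
    have "(\<Sum>i\<in>{p..<r}. ennreal ((J (t (Suc i)))\<^sup>2) * indicator {t i<..t (Suc i)} s)
        = (\<Sum>i\<in>{p..<r}. ennreal ((J s)\<^sup>2) * indicator {t i<..t (Suc i)} s)"
      using step by (intro sum.cong refl) (auto split: split_indicator)
    also have "\<dots> = ennreal ((J s)\<^sup>2) * indicator {t p<..t r} s"
      using sum_indicator_cells[OF t pr, of s] by (simp add: sum_distrib_left[symmetric])
    also have "\<dots> \<le> ennreal (2 * k) * indicator {t p<..t r} s
      + ennreal 2 * (ennreal ((J s - H' s)\<^sup>2) * indicator {0..L} s)"
    proof (cases "s \<in> {t p<..t r}")
      case True
      then have s: "s \<in> {0..L}" using t0 tL by auto
      then have H's: "H' s = H s" by (simp add: H'_def)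
      have "0 \<le> (J s - 2 * H s)\<^sup>2" by simp
      then have "(J s)\<^sup>2 \<le> 2 * (H s)\<^sup>2 + 2 * (J s - H s)\<^sup>2"
        by (simp add: power2_eq_square algebra_simps)
      also have "\<dots> \<le> 2 * k + 2 * (J s - H s)\<^sup>2" using bound[OF True] by simp
      finally have "ennreal ((J s)\<^sup>2) \<le> ennreal (2 * k + 2 * (J s - H s)\<^sup>2)" by (rule ennreal_leI)
      also have "\<dots> = ennreal (2 * k) + ennreal 2 * ennreal ((J s - H s)\<^sup>2)"
        using k by (subst ennreal_plus) (simp_all add: ennreal_mult)
      finally show ?thesis using True s H's by simp
    qed simp
    finally show "(\<Sum>i\<in>{p..<r}. ennreal ((J (t (Suc i)))\<^sup>2) * indicator {t i<..t (Suc i)} s) \<le> \<dots>" .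
  qed
  also have "\<dots> = ennreal (2 * k) * ennreal (t r - t p)
      + ennreal 2 * (\<integral>\<^sup>+s\<in>{0..L}. ennreal ((J s - H' s)\<^sup>2) \<partial>lborel)"
    using tpr by (simp add: nn_integral_add nn_integral_cmult nn_integral_cmult_indicator)
  also have "(\<integral>\<^sup>+s\<in>{0..L}. ennreal ((J s - H' s)\<^sup>2) \<partial>lborel) = (\<integral>\<^sup>+s\<in>{0..L}. ennreal ((J s - H s)\<^sup>2) \<partial>lborel)"
    by (intro nn_integral_cong) (auto simp: H'_def split: split_indicator)
  also have "ennreal (2 * k) * ennreal (t r - t p) + ennreal 2 * \<dots>
      \<le> ennreal (2 * k) * ennreal (t r - t p) + ennreal 2 * ennreal \<eta>"
    by (intro add_left_mono mult_left_mono close) simp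
  also have "\<dots> = ennreal (2 * k * (t r - t p) + 2 * \<eta>)"
    using k tpr \<eta> by (simp add: ennreal_plus ennreal_mult)
  finally show ?thesis using k tpr \<eta> by (simp del: ennreal_plus)
qed

definition endpoints :: "'a simple \<Rightarrow> real set" where
  "endpoints S = fst ` set S \<union> (fst \<circ> snd) ` set S"

lemma endpointsI: "(a, b, \<xi>) \<in> set S \<Longrightarrow> a \<in> endpoints S" "(a, b, \<xi>) \<in> set S \<Longrightarrow> b \<in> endpoints S"
  by (force simp: endpoints_def)+

lemma simple_process_const_on_cell:
  assumes grid: "\<And>d. d \<in> endpoints S \<Longrightarrow> d \<le> x \<or> y \<le> d" and s: "s \<in> {x<..y}"
  shows "simple_process S s \<omega> = simple_process S y \<omega>"
proof -
  have "(case e of (a, b, \<xi>) \<Rightarrow> \<xi> \<omega> * indicator {a<..b} s)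
      = (case e of (a, b, \<xi>) \<Rightarrow> \<xi> \<omega> * (indicator {a<..b} y :: real))" if "e \<in> set S" for e
  proof -
    obtain a b \<xi> where e: "e = (a, b, \<xi>)" by (cases e)
    show ?thesis
      using grid[OF endpointsI(1)[OF that[unfolded e]]] grid[OF endpointsI(2)[OF that[unfolded e]]] s
      unfolding e by (auto simp: indicator_def)
  qed
  then show ?thesis unfolding simple_process_def by (intro arg_cong[where f=sum_list] map_cong refl)
qed

text \<open>Each interval of the simple process contains the cell \<open>(x, y]\<close> or misses it, and exactly those that
  contain it contribute the increment of \<open>B\<close>. On an empty cell both sides vanish.\<close>

lemma simple_integral_increment_on_cell:
  assumes grid: "\<And>d. d \<in> endpoints S \<Longrightarrow> d \<le> x \<or> y \<le> d" and xy: "x \<le> y"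
    and S: "\<And>a b \<xi>. (a, b, \<xi>) \<in> set S \<Longrightarrow> a \<le> b"
  shows "simple_integral B S y \<omega> - simple_integral B S x \<omega> = simple_process S y \<omega> * (B y \<omega> - B x \<omega>)"
proof -
  have "(case e of (a, b, \<xi>) \<Rightarrow> \<xi> \<omega> * (B (min b y) \<omega> - B (min a y) \<omega>))
      - (case e of (a, b, \<xi>) \<Rightarrow> \<xi> \<omega> * (B (min b x) \<omega> - B (min a x) \<omega>))
      = (case e of (a, b, \<xi>) \<Rightarrow> \<xi> \<omega> * indicator {a<..b} y) * (B y \<omega> - B x \<omega>)" if "e \<in> set S" for e
  proof -
    obtain a b \<xi> where e: "e = (a, b, \<xi>)" by (cases e)
    have "a \<le> x \<or> y \<le> a" "b \<le> x \<or> y \<le> b" "a \<le> b"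
      using grid[OF endpointsI(1)[OF that[unfolded e]]] grid[OF endpointsI(2)[OF that[unfolded e]]]
        S[OF that[unfolded e]] by auto
    then show ?thesis
      using xy unfolding e by (cases "x = y") (auto simp: indicator_def min_def algebra_simps)
  qed
  then show ?thesis
    unfolding simple_integral_def simple_process_def sum_list_subtractf[symmetric] sum_list_mult_const[symmetric]
    by (intro arg_cong[where f=sum_list] map_cong refl)
qed

lemma simple_process_measurable_time: "(\<lambda>s. simple_process S s \<omega>) \<in> borel_measurable borel"
  unfolding simple_process_def by (induction S) auto

context usual_filtered_space
begin

text \<open>The value of the simple process on the cell \<open>(x, y]\<close> only involves coefficients of intervals that
  start before \<open>y\<close>, hence, as no endpoint lies inside the cell, at or before \<open>x\<close>.\<close>

lemma simple_process_predictable_on_grid: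
  assumes S: "is_simple Ft S" and grid: "\<And>d. d \<in> endpoints S \<Longrightarrow> d \<le> x \<or> y \<le> d" and xy: "x \<le> y"
  shows "(\<lambda>\<omega>. simple_process S y \<omega>) \<in> borel_measurable (Ft (ennreal x))"
    and "\<exists>K. \<forall>\<omega>\<in>space M. \<bar>simple_process S y \<omega>\<bar> \<le> K"
proof -
  have "(\<lambda>\<omega>. simple_process S' y \<omega>) \<in> borel_measurable (Ft (ennreal x)) \<and> (\<exists>K. \<forall>\<omega>\<in>space M. \<bar>simple_process S' y \<omega>\<bar> \<le> K)"
    if "set S' \<subseteq> set S" for S'
    using that
  proof (induction S')
    case Nil
    then show ?case by (auto simp: simple_process_def)
  next
    case (Cons e S')
    obtain a b \<xi> where e: "e = (a, b, \<xi>)" by (cases e)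
    have in_S: "(a, b, \<xi>) \<in> set S" using Cons e by simp
    then have \<xi>: "0 \<le> a" "\<xi> \<in> borel_measurable (Ft (ennreal a))" "\<exists>K. \<forall>\<omega>\<in>space M. \<bar>\<xi> \<omega>\<bar> \<le> K"
      using S unfolding is_simple_def by (auto simp: space_F)
    have sp: "simple_process (e # S') y \<omega> = \<xi> \<omega> * indicator {a<..b} y + simple_process S' y \<omega>" for \<omega>
      by (simp add: simple_process_def e)
    have IH: "(\<lambda>\<omega>. simple_process S' y \<omega>) \<in> borel_measurable (Ft (ennreal x))"
      "\<exists>K. \<forall>\<omega>\<in>space M. \<bar>simple_process S' y \<omega>\<bar> \<le> K" using Cons by auto
    have 1: "(\<lambda>\<omega>. \<xi> \<omega> * indicator {a<..b} y) \<in> borel_measurable (Ft (ennreal x))"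
    proof (cases "y \<in> {a<..b}")
      case True
      then have "a \<le> x" using grid[OF endpointsI(1)[OF in_S]] by auto
      then show ?thesis using measurable_Ft_mono[OF \<xi>(2) ennreal_leI] True by simp
    qed simp
    have 2: "\<exists>K. \<forall>\<omega>\<in>space M. \<bar>\<xi> \<omega> * indicator {a<..b} y + simple_process S' y \<omega>\<bar> \<le> K"
    proof -
      obtain K1 K2 where K: "\<And>\<omega>. \<omega> \<in> space M \<Longrightarrow> \<bar>\<xi> \<omega>\<bar> \<le> K1"
        "\<And>\<omega>. \<omega> \<in> space M \<Longrightarrow> \<bar>simple_process S' y \<omega>\<bar> \<le> K2" using \<xi>(3) IH(2) by blast
      show ?thesis
      proof (intro exI[of _ "K1 + K2"] ballI)
        fix \<omega> assume w: "\<omega> \<in> space M"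
        have "\<bar>\<xi> \<omega> * indicator {a<..b} y\<bar> \<le> \<bar>\<xi> \<omega>\<bar>" by (simp add: indicator_def)
        then show "\<bar>\<xi> \<omega> * indicator {a<..b} y + simple_process S' y \<omega>\<bar> \<le> K1 + K2"
          using K(1)[OF w] K(2)[OF w] by linarith
      qed
    qed
    show ?case unfolding sp using 1 2 IH by (intro conjI borel_measurable_add)
  qed
  from this[OF order_refl]
  show "(\<lambda>\<omega>. simple_process S y \<omega>) \<in> borel_measurable (Ft (ennreal x))"
    and "\<exists>K. \<forall>\<omega>\<in>space M. \<bar>simple_process S y \<omega>\<bar> \<le> K" by auto
qed

end

section \<open>A tail bound for increments of Ito integrals\<close>

context usual_filtered_space
begin

text \<open>Chebyshev's inequality for a discrete stochastic integral over \<open>[\<sigma>, \<theta>)\<close>. The event \<open>A j\<close> switches the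
  integrand off as soon as its accumulated energy, including the coming cell, would exceed \<open>q\<close>; this is
  decided at time \<open>t j\<close> because \<open>z j\<close> is. The second moment is then at most \<open>q\<close> on \<open>{\<sigma> < \<theta>}\<close>, and the
  integral vanishes off that event. The resulting factor \<open>P(\<sigma> < \<theta>)\<close> is what good-\<open>\<lambda>\<close> inequalities need.\<close>

lemma stopped_energy_bounded_sum:
  fixes t :: "nat \<Rightarrow> real" and z :: "nat \<Rightarrow> 'a \<Rightarrow> real" and n :: nat
  assumes bm: "brownian_motion M Ft B" and t: "mono t" "\<And>j. 0 \<le> t j"
    and z: "\<And>j. z j \<in> borel_measurable (Ft (ennreal (t j)))" "\<And>j. \<exists>K. \<forall>\<omega>\<in>space M. \<bar>z j \<omega>\<bar> \<le> K"
    and \<sigma>: "stopping_time Ft \<sigma>" and \<theta>: "stopping_time Ft \<theta>" and q: "0 \<le> q" and c: "0 < c"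
  defines "A \<equiv> \<lambda>j \<omega>. \<sigma> \<omega> \<le> ennreal (t j) \<and> ennreal (t j) < \<theta> \<omega> \<and>
    (\<Sum>i\<le>j. if \<sigma> \<omega> \<le> ennreal (t i) then (z i \<omega>)\<^sup>2 * (t (Suc i) - t i) else 0) \<le> q"
  defines "G \<equiv> \<lambda>\<omega>. \<Sum>j<n. (if A j \<omega> then z j \<omega> else 0) * (B (t (Suc j)) \<omega> - B (t j) \<omega>)"
  shows "G \<in> borel_measurable M" and "prob {\<omega>\<in>space M. c \<le> \<bar>G \<omega>\<bar>} \<le> q / c\<^sup>2 * prob {\<omega>\<in>space M. \<sigma> \<omega> < \<theta> \<omega>}"
proof -
  define \<zeta> where "\<zeta> j \<omega> = (if A j \<omega> then z j \<omega> else 0)" for j \<omega>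
  have tm: "t i \<le> t j" if "i \<le> j" for i j by (intro monoD[OF t(1)] that)
  have zm: "z i \<in> borel_measurable (Ft (ennreal (t j)))" if "i \<le> j" for i j
    using measurable_Ft_mono[OF z(1) ennreal_leI[OF tm[OF that]]] .
  have \<sigma>m: "Measurable.pred (Ft (ennreal (t j))) (\<lambda>\<omega>. \<sigma> \<omega> \<le> ennreal (t i))" if "i \<le> j" for i j
    by (intro stopping_time_le_const[OF \<sigma>] ennreal_leI tm that)
  have [measurable]: "Measurable.pred (Ft (ennreal (t j))) (\<lambda>\<omega>. ennreal (t j) < \<theta> \<omega>)" for j
    by (rule stopping_timeD2[OF \<theta>])
  have [measurable]: "(\<lambda>\<omega>. \<Sum>i\<le>j. if \<sigma> \<omega> \<le> ennreal (t i) then (z i \<omega>)\<^sup>2 * (t (Suc i) - t i) else 0) \<in> borel_measurable (Ft (ennreal (t j)))" for j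
  proof (intro borel_measurable_sum)
    fix i assume "i \<in> {..j}"
    then have [measurable]: "z i \<in> borel_measurable (Ft (ennreal (t j)))" "Measurable.pred (Ft (ennreal (t j))) (\<lambda>\<omega>. \<sigma> \<omega> \<le> ennreal (t i))"
      using zm \<sigma>m by auto
    show "(\<lambda>\<omega>. if \<sigma> \<omega> \<le> ennreal (t i) then (z i \<omega>)\<^sup>2 * (t (Suc i) - t i) else 0) \<in> borel_measurable (Ft (ennreal (t j)))"
      by measurable
  qed
  have \<zeta>m: "\<zeta> j \<in> borel_measurable (Ft (ennreal (t j)))" for j
  proof -
    note [measurable] = z(1)[of j] \<sigma>m[OF order_refl, of j]
    show ?thesis unfolding \<zeta>_def A_def by measurable
  qed
  obtain K where K: "\<And>j \<omega>. \<omega> \<in> space M \<Longrightarrow> \<bar>z j \<omega>\<bar> \<le> K j" using z(2) by metis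
  have \<zeta>K: "\<bar>\<zeta> j \<omega>\<bar> \<le> K j" if "\<omega> \<in> space M" for j \<omega>
    using K[OF that, of j] by (auto simp: \<zeta>_def)
  note iso = martingale_transform_isometry[where t=t and \<zeta>=\<zeta> and K=K and n=n, OF bm t(2) tm[OF le_SucI[OF order_refl]] \<zeta>m \<zeta>K]
  have G: "G = (\<lambda>\<omega>. \<Sum>j<n. \<zeta> j \<omega> * (B (t (Suc j)) \<omega> - B (t j) \<omega>))"
    by (simp add: G_def \<zeta>_def)
  have G_apply: "(\<Sum>j<n. \<zeta> j \<omega> * (B (t (Suc j)) \<omega> - B (t j) \<omega>)) = G \<omega>" for \<omega> by (simp add: G)
  note iso = iso[unfolded G_apply]
  show Gm: "G \<in> borel_measurable M" by (rule measurable_Ft_M[OF conjunct1[OF iso]])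
  have G2: "integrable M (\<lambda>\<omega>. (G \<omega>)\<^sup>2)" by (rule iso[THEN conjunct2, THEN conjunct1])
  note [measurable] = measurable_Ft_M[OF \<zeta>m]
  have \<zeta>i: "integrable M (\<lambda>\<omega>. (\<zeta> j \<omega>)\<^sup>2)" for j
  proof (rule integrable_const_bound[of _ "(K j)\<^sup>2"])
    show "AE \<omega> in M. norm ((\<zeta> j \<omega>)\<^sup>2) \<le> (K j)\<^sup>2"
    proof (rule AE_I2)
      fix \<omega> assume "\<omega> \<in> space M"
      from power_mono[OF \<zeta>K[OF this, of j], of 2] show "norm ((\<zeta> j \<omega>)\<^sup>2) \<le> (K j)\<^sup>2" by simp
    qed
  qed measurable
  have [measurable]: "\<sigma> \<in> borel_measurable M" "\<theta> \<in> borel_measurable M"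
    using measurable_stopping_time[OF \<sigma>, of M] measurable_stopping_time[OF \<theta>, of M] sub_M
    by (auto simp: subalgebra_def)
  let ?D = "{\<omega>\<in>space M. \<sigma> \<omega> < \<theta> \<omega>}"
  have D: "?D \<in> events" by measurable
  have Di: "integrable M (\<lambda>\<omega>. q * indicator ?D \<omega>)"
    by (intro integrable_mult_right integrable_real_indicator D) (simp add: less_top[symmetric])
  have "expectation (\<lambda>\<omega>. (G \<omega>)\<^sup>2) = (\<Sum>j<n. expectation (\<lambda>\<omega>. (\<zeta> j \<omega>)\<^sup>2) * (t (Suc j) - t j))"
    by (rule iso[THEN conjunct2, THEN conjunct2])
  also have "\<dots> = expectation (\<lambda>\<omega>. \<Sum>j<n. (\<zeta> j \<omega>)\<^sup>2 * (t (Suc j) - t j))"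
    using \<zeta>i by simp
  also have "\<dots> \<le> expectation (\<lambda>\<omega>. q * indicator ?D \<omega>)"
  proof (rule integral_mono)
    fix \<omega> assume \<omega>: "\<omega> \<in> space M"
    show "(\<Sum>j<n. (\<zeta> j \<omega>)\<^sup>2 * (t (Suc j) - t j)) \<le> q * indicator ?D \<omega>"
    proof (cases "\<sigma> \<omega> < \<theta> \<omega>")
      case True
      define a where "a i = (if \<sigma> \<omega> \<le> ennreal (t i) then (z i \<omega>)\<^sup>2 * (t (Suc i) - t i) else 0)" for i
      have "(\<Sum>j<n. (\<zeta> j \<omega>)\<^sup>2 * (t (Suc j) - t j))
          = (\<Sum>j<n. if (\<sigma> \<omega> \<le> ennreal (t j) \<and> ennreal (t j) < \<theta> \<omega>) \<and> (\<Sum>i\<le>j. a i) \<le> q then a j else 0)"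
        by (intro sum.cong refl) (simp add: \<zeta>_def A_def a_def)
      also have "\<dots> \<le> q"
        using tm by (intro sum_until_budget_le q) (auto simp: a_def)
      finally show ?thesis using True \<omega> by simp
    next
      case False
      then have "\<zeta> j \<omega> = 0" for j unfolding \<zeta>_def A_def by (auto dest: le_less_trans)
      then show ?thesis using q by simp
    qed
  qed (use \<zeta>i Di in auto)
  also have "\<dots> = q * prob ?D" by simp
  finally have E: "expectation (\<lambda>\<omega>. (G \<omega>)\<^sup>2) \<le> q * prob ?D" .
  have "{\<omega>\<in>space M. c \<le> \<bar>G \<omega>\<bar>} = {\<omega>\<in>space M. c\<^sup>2 \<le> (G \<omega>)\<^sup>2}"
    using c abs_le_square_iff[of c] by auto
  then have "prob {\<omega>\<in>space M. c \<le> \<bar>G \<omega>\<bar>} = prob {\<omega>\<in>space M. c\<^sup>2 \<le> (G \<omega>)\<^sup>2}" by simp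
  also have "\<dots> \<le> expectation (\<lambda>\<omega>. (G \<omega>)\<^sup>2) / c\<^sup>2"
    using c by (intro integral_Markov_inequality_measure[where A="{}"] G2) auto
  also have "\<dots> \<le> q * prob ?D / c\<^sup>2" using c by (intro divide_right_mono E) auto
  finally show "prob {\<omega>\<in>space M. c \<le> \<bar>G \<omega>\<bar>} \<le> q / c\<^sup>2 * prob ?D" by simp
qed

text \<open>An increment of the Ito integral between stopping times can hardly be of size \<open>c\<close> while the integrand
  stays within \<open>[- sqrt k, sqrt k]\<close> in between. This is Chebyshev's inequality for
  \<open>E (I\<^sub>\<theta> - I\<^sub>\<sigma>)\<^sup>2 = E \<integral>\<^sub>\<sigma>\<^sup>\<theta> H\<^sup>2 ds \<le> k T P(\<sigma> < \<theta>)\<close>, up to the constant. The proof replaces \<open>H\<close> and \<open>I\<close>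
  by a simple process and its integral, and \<open>\<sigma>\<close>, \<open>\<theta>\<close> by the next grid times, outside an exceptional
  event \<open>?N\<close> of small probability. On the remaining part of \<open>E\<close> the energy budget is never exhausted,
  so the stopped sum \<open>G\<close> of the preceding lemma equals the full increment of the simple integral.\<close>

lemma ito_increment_tail:
  assumes bm: "brownian_motion M Ft B" and ito: "ito_integral M Ft B H I" and H: "continuous_adapted M Ft H"
    and \<sigma>: "stopping_time Ft \<sigma>" and \<theta>: "stopping_time Ft \<theta>"
    and T: "0 < T" "\<And>\<omega>. \<omega> \<in> space M \<Longrightarrow> \<theta> \<omega> \<le> ennreal T"
    and k: "0 < k" and c: "0 < c" and E: "E \<in> events"
    and E_lt: "AE \<omega> in M. \<omega> \<in> E \<longrightarrow> \<sigma> \<omega> < \<theta> \<omega>"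
    and E_bound: "AE \<omega> in M. \<omega> \<in> E \<longrightarrow> (\<forall>s\<ge>0. \<sigma> \<omega> \<le> ennreal s \<and> ennreal s \<le> \<theta> \<omega> \<longrightarrow> (H s \<omega>)\<^sup>2 \<le> k)"
    and E_incr: "AE \<omega> in M. \<omega> \<in> E \<longrightarrow> c \<le> \<bar>I (enn2real (\<theta> \<omega>)) \<omega> - I (enn2real (\<sigma> \<omega>)) \<omega>\<bar>"
  shows "prob E \<le> 40 * k * T / c\<^sup>2 * prob {\<omega>\<in>space M. \<sigma> \<omega> < \<theta> \<omega>}"
proof (rule field_le_epsilon)
  fix e :: real assume "0 < e"
  define \<epsilon> where "\<epsilon> = e / 4"
  have \<epsilon>: "0 < \<epsilon>" using \<open>0 < e\<close> by (simp add: \<epsilon>_def)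
  \<comment> \<open>Four errors of size \<open>\<eta>\<close> may cost at most half of \<open>c\<close>, and \<open>2 * \<eta>\<close> at most \<open>2 * k * T\<close> of energy.\<close>
  define \<eta> where "\<eta> = min (k * T) (c / 8)"
  have \<eta>: "0 < \<eta>" "\<eta> \<le> k * T" "\<eta> \<le> c / 8" using k T c by (auto simp: \<eta>_def)
  have contI: "continuous_adapted M Ft I" using ito by (simp add: ito_integral_def)
  have adapted_M: "X s \<in> borel_measurable M" if "continuous_adapted M Ft X" "0 \<le> s" for X s
    using that measurable_Ft_M unfolding continuous_adapted_def adapted_def by blast
  have T2: "0 \<le> 2 * T" using T by simp
  from ito obtain S :: "nat \<Rightarrow> 'a simple" where S: "\<And>j. is_simple Ft (S j)"
    and S_H: "tendsto_zero_in_prob M (\<lambda>j \<omega>. \<integral>\<^sup>+s\<in>{0..2*T}. ennreal ((simple_process (S j) s \<omega> - H s \<omega>)\<^sup>2) \<partial>lborel)"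
    and S_I: "tendsto_zero_in_prob M (\<lambda>j \<omega>. SUP s\<in>{0..2*T}. ennreal \<bar>simple_integral B (S j) s \<omega> - I s \<omega>\<bar>)"
    unfolding ito_integral_def using T2 by blast
  define NH where "NH j = {\<omega>\<in>space M. (\<integral>\<^sup>+s\<in>{0..2*T}. ennreal ((simple_process (S j) s \<omega> - H s \<omega>)\<^sup>2) \<partial>lborel) > ennreal \<eta>}" for j
  define NI where "NI j = {\<omega>\<in>space M. (SUP s\<in>{0..2*T}. ennreal \<bar>simple_integral B (S j) s \<omega> - I s \<omega>\<bar>) > ennreal \<eta>}" for j
  have N_events: "NH j \<in> events" "NI j \<in> events" for j
  proof -
    have [measurable]: "(\<lambda>\<omega>. \<integral>\<^sup>+s\<in>{0..2*T}. ennreal ((simple_process (S j) s \<omega> - H s \<omega>)\<^sup>2) \<partial>lborel) \<in> borel_measurable M"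
      "(\<lambda>\<omega>. SUP s\<in>{0..2*T}. ennreal \<bar>simple_integral B (S j) s \<omega> - I s \<omega>\<bar>) \<in> borel_measurable M"
      using S_H S_I unfolding tendsto_zero_in_prob_def by auto
    show "NH j \<in> events" "NI j \<in> events" unfolding NH_def NI_def by measurable
  qed
  have "(\<lambda>j. prob (NH j)) \<longlonglongrightarrow> 0" "(\<lambda>j. prob (NI j)) \<longlonglongrightarrow> 0"
    using S_H S_I \<eta>(1) unfolding tendsto_zero_in_prob_def NH_def NI_def by blast+
  then have "\<forall>\<^sub>F j in sequentially. prob (NH j) < \<epsilon> \<and> prob (NI j) < \<epsilon>"
    using \<epsilon> by (intro eventually_conj order_tendstoD(2))
  then obtain j where N: "prob (NH j) < \<epsilon>" "prob (NI j) < \<epsilon>" by (auto simp: eventually_sequentially)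
  obtain h1 N1 where h1: "0 < h1" "N1 \<in> events" "prob N1 < \<epsilon>"
    and osc_I: "AE \<omega> in M. \<omega> \<notin> N1 \<longrightarrow> (\<forall>s\<in>{0..2*T}. \<forall>t\<in>{0..2*T}. \<bar>s - t\<bar> \<le> h1 \<longrightarrow> \<bar>I s \<omega> - I t \<omega>\<bar> \<le> \<eta>)"
    using small_oscillation_with_high_probability[where X=I and T="2*T", OF adapted_M[OF contI] _ \<epsilon> \<eta>(1)] contI
    unfolding continuous_adapted_def by blast
  have "AE \<omega> in M. continuous_on {0..} (\<lambda>t. (H t \<omega>)\<^sup>2)"
    using H unfolding continuous_adapted_def by (auto intro: continuous_on_power)
  then obtain h2 N2 where h2: "0 < h2" "N2 \<in> events" "prob N2 < \<epsilon>"
    and osc_H: "AE \<omega> in M. \<omega> \<notin> N2 \<longrightarrow> (\<forall>s\<in>{0..2*T}. \<forall>t\<in>{0..2*T}. \<bar>s - t\<bar> \<le> h2 \<longrightarrow> \<bar>(H s \<omega>)\<^sup>2 - (H t \<omega>)\<^sup>2\<bar> \<le> k)"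
    using small_oscillation_with_high_probability[where X="\<lambda>t \<omega>. (H t \<omega>)\<^sup>2" and T="2*T",
        OF borel_measurable_power[OF adapted_M[OF H]] _ \<epsilon> k]
    by blast
  \<comment> \<open>Rounding \<open>\<theta> \<le> T\<close> up to the grid then stays within \<open>[0, 2 * T]\<close>, where the approximation is controlled.\<close>
  define h where "h = min T (min h1 h2)"
  have h: "0 < h" "h \<le> T" "h \<le> h1" "h \<le> h2" using T h1 h2 by (auto simp: h_def)
  have "finite (endpoints (S j))" "endpoints (S j) \<subseteq> {0..}"
    using S[of j] unfolding endpoints_def is_simple_def by fastforce+
  then obtain t n where t: "mono t" "\<And>i. 0 \<le> t i"
    and grid: "\<And>d i. d \<in> endpoints (S j) \<Longrightarrow> d \<le> t i \<or> t (Suc i) \<le> d"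
    and dense: "\<And>x. 0 \<le> x \<Longrightarrow> x \<le> T \<Longrightarrow> \<exists>j\<le>n. x \<le> t j \<and> t j \<le> x + h"
    using refining_grid_exists[of "endpoints (S j)" h T] h(1) by metis
  have tm: "t i \<le> t (Suc i)" for i by (intro monoD[OF t(1)]) simp
  define z where "z i \<omega> = simple_process (S j) (t (Suc i)) \<omega>" for i \<omega>
  have z: "z i \<in> borel_measurable (Ft (ennreal (t i)))" "\<exists>K. \<forall>\<omega>\<in>space M. \<bar>z i \<omega>\<bar> \<le> K" for i
    using simple_process_predictable_on_grid[OF S[of j] grid tm, of i] unfolding z_def[abs_def] by auto
  \<comment> \<open>Energy at most \<open>2 * (2 * k) * (2 * T) + 2 * \<eta>\<close>: the bound \<open>k\<close> on \<open>H\<^sup>2\<close> grows to \<open>2 * k\<close> up to the rounded time.\<close>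
  define q where "q = 10 * k * T"
  have q: "0 \<le> q" using k T by (simp add: q_def)
  define A where "A i \<omega> \<longleftrightarrow> \<sigma> \<omega> \<le> ennreal (t i) \<and> ennreal (t i) < \<theta> \<omega> \<and>
    (\<Sum>l\<le>i. if \<sigma> \<omega> \<le> ennreal (t l) then (z l \<omega>)\<^sup>2 * (t (Suc l) - t l) else 0) \<le> q" for i \<omega>
  define G where "G \<omega> = (\<Sum>i<n. (if A i \<omega> then z i \<omega> else 0) * (B (t (Suc i)) \<omega> - B (t i) \<omega>))" for \<omega>
  have c2: "0 < c / 2" using c by simp
  note tail = stopped_energy_bounded_sum[OF bm t z \<sigma> \<theta> q c2, of n, folded A_def, folded G_def]
  let ?Z = "{\<omega>\<in>space M. c / 2 \<le> \<bar>G \<omega>\<bar>}"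
  let ?N = "NH j \<union> NI j \<union> N1 \<union> N2"
  have [measurable]: "G \<in> borel_measurable M" using tail(1) .
  have "AE \<omega> in M. \<omega> \<in> E \<longrightarrow> \<omega> \<in> ?Z \<union> ?N"
    using AE_space E_lt E_bound E_incr osc_I osc_H contI[unfolded continuous_adapted_def, THEN conjunct2]
      H[unfolded continuous_adapted_def, THEN conjunct2]
  proof eventually_elim
    case (elim \<omega>)
    show ?case
    proof (intro impI)
      assume wE: "\<omega> \<in> E"
      have "c / 2 \<le> \<bar>G \<omega>\<bar>" if good: "\<omega> \<notin> NH j" "\<omega> \<notin> NI j" "\<omega> \<notin> N1" "\<omega> \<notin> N2"
      proof -
        have w: "\<omega> \<in> space M" and lt: "\<sigma> \<omega> < \<theta> \<omega>" using elim wE by auto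
        define s u where "s = enn2real (\<sigma> \<omega>)" and "u = enn2real (\<theta> \<omega>)"
        have u: "\<theta> \<omega> = ennreal u" "0 \<le> u" "u \<le> T"
          using T(2)[OF w] T(1) unfolding u_def by (cases "\<theta> \<omega>"; auto simp: top_unique)+
        have s: "\<sigma> \<omega> = ennreal s" "0 \<le> s" "s < u"
          using lt u unfolding s_def by (cases "\<sigma> \<omega>"; auto simp: ennreal_less_iff)+
        have sT: "s \<le> T" using s u by simp
        obtain p r where pr: "p \<le> r" "r \<le> n" and tp: "s \<le> t p" "t p \<le> s + h" and tr: "u \<le> t r" "t r \<le> u + h"
          and between: "\<And>i. (s \<le> t i \<and> t i < u) \<longleftrightarrow> i \<in> {p..<r}"
          using grid_indices_between[OF t(1) less_imp_le[OF s(3)] dense[OF s(2) sT] dense[OF u(2,3)]] by blast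
        have tr2: "t r \<le> 2 * T" using tr u h by linarith
        have tp2: "t p \<le> t r" by (intro monoD[OF t(1)] pr)
        have energy: "(\<Sum>i\<in>{p..<m}. (z i \<omega>)\<^sup>2 * (t (Suc i) - t i)) \<le> q" if m: "p \<le> m" "m \<le> r" for m
        proof -
          have tmr: "t m \<le> t r" by (intro monoD[OF t(1)] m)
          have "(\<Sum>i\<in>{p..<m}. (z i \<omega>)\<^sup>2 * (t (Suc i) - t i)) \<le> 2 * (2 * k) * (t m - t p) + 2 * \<eta>"
            unfolding z_def
          proof (rule step_function_energy_le[OF t(1) m(1) t(2), where L="2*T"])
            show "t m \<le> 2 * T" using tmr tr2 by simp
            show "simple_process (S j) x \<omega> = simple_process (S j) (t (Suc i)) \<omega>" if "x \<in> {t i<..t (Suc i)}" for i x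
              by (rule simple_process_const_on_cell[OF grid that])
            show "(H x \<omega>)\<^sup>2 \<le> 2 * k" if x: "x \<in> {t p<..t m}" for x
            proof -
              define y where "y = min x u"
              have xs: "s \<le> x" "x \<le> u + h" "0 \<le> x" "x \<le> 2 * T" using x tp tr tmr tr2 s by auto
              then have y: "s \<le> y" "y \<le> u" "0 \<le> y" "y \<le> 2 * T" "\<bar>x - y\<bar> \<le> h2"
                using s u h by (auto simp: y_def)
              have "(H y \<omega>)\<^sup>2 \<le> k" using elim(3) wE y s u by (simp add: ennreal_leI)
              moreover have "\<bar>(H x \<omega>)\<^sup>2 - (H y \<omega>)\<^sup>2\<bar> \<le> k" using elim(6) good(4) xs y by simp
              ultimately show ?thesis by linarith
            qed
            show "(\<integral>\<^sup>+x\<in>{0..2*T}. ennreal ((simple_process (S j) x \<omega> - H x \<omega>)\<^sup>2) \<partial>lborel) \<le> ennreal \<eta>"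
              using good(1) w unfolding NH_def by (simp add: not_less)
          qed (use k \<eta> elim in \<open>auto intro: simple_process_measurable_time\<close>)
          also have "\<dots> \<le> 2 * (2 * k) * (2 * T) + 2 * (k * T)"
            using k tmr tr2 t(2)[of p] \<eta> by (intro add_mono mult_left_mono) auto
          also have "\<dots> = q" by (simp add: q_def)
          finally show ?thesis .
        qed
        have A: "A i \<omega> \<longleftrightarrow> i \<in> {p..<r}" for i
        proof -
          have "(\<Sum>l\<le>i. if \<sigma> \<omega> \<le> ennreal (t l) then (z l \<omega>)\<^sup>2 * (t (Suc l) - t l) else 0) \<le> q" if i: "i \<in> {p..<r}"
          proof -
            have "(\<Sum>l\<le>i. if \<sigma> \<omega> \<le> ennreal (t l) then (z l \<omega>)\<^sup>2 * (t (Suc l) - t l) else 0)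
                = (\<Sum>l\<in>{p..<Suc i}. (z l \<omega>)\<^sup>2 * (t (Suc l) - t l))"
            proof (rule sum.mono_neutral_cong_right)
              show "\<forall>l\<in>{..i} - {p..<Suc i}. (if \<sigma> \<omega> \<le> ennreal (t l) then (z l \<omega>)\<^sup>2 * (t (Suc l) - t l) else 0) = 0"
              proof
                fix l assume l: "l \<in> {..i} - {p..<Suc i}"
                then have "t l \<le> t i" by (intro monoD[OF t(1)]) simp
                moreover have "t i < u" using between[of i] i by simp
                ultimately have "\<not> s \<le> t l" using between[of l] l by auto
                then show "(if \<sigma> \<omega> \<le> ennreal (t l) then (z l \<omega>)\<^sup>2 * (t (Suc l) - t l) else 0) = 0"
                  using s t(2)[of l] by simp
              qed
              show "(if \<sigma> \<omega> \<le> ennreal (t l) then (z l \<omega>)\<^sup>2 * (t (Suc l) - t l) else 0) = (z l \<omega>)\<^sup>2 * (t (Suc l) - t l)"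
                if l: "l \<in> {p..<Suc i}" for l
              proof -
                have "s \<le> t l" using between[of l] l i by auto
                then show ?thesis using s by (simp add: ennreal_leI)
              qed
            qed auto
            also have "\<dots> \<le> q" using i by (intro energy) auto
            finally show ?thesis .
          qed
          then show ?thesis
            unfolding A_def between[symmetric] s u using s t(2)[of i] by (auto simp: ennreal_less_iff)
        qed
        define J where "J x = simple_integral B (S j) x \<omega>" for x
        have inc: "J (t (Suc i)) - J (t i) = z i \<omega> * (B (t (Suc i)) \<omega> - B (t i) \<omega>)" for i
          unfolding J_def z_def using S[of j]
          by (intro simple_integral_increment_on_cell grid tm) (auto simp: is_simple_def)
        have "G \<omega> = (\<Sum>i\<in>{p..<r}. J (t (Suc i)) - J (t i))"
          unfolding G_def inc using pr
          by (intro sum.mono_neutral_cong_right) (auto simp: A)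
        also have "\<dots> = J (t r) - J (t p)" using pr(1) by (rule sum_Suc_diff')
        finally have G: "G \<omega> = J (t r) - J (t p)" .
        have JI: "\<bar>J x - I x \<omega>\<bar> \<le> \<eta>" if "0 \<le> x" "x \<le> 2 * T" for x
        proof -
          have "ennreal \<bar>J x - I x \<omega>\<bar> \<le> (SUP x\<in>{0..2*T}. ennreal \<bar>simple_integral B (S j) x \<omega> - I x \<omega>\<bar>)"
            unfolding J_def using that by (intro SUP_upper) simp
          also have "\<dots> \<le> ennreal \<eta>" using good(2) w unfolding NI_def by (simp add: not_less)
          finally show ?thesis using \<eta> by simp
        qed
        have "\<bar>I (t r) \<omega> - I u \<omega>\<bar> \<le> \<eta>" "\<bar>I (t p) \<omega> - I s \<omega>\<bar> \<le> \<eta>"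
          using elim(5) good(3) tr tp tr2 tp2 t(2)[of r] t(2)[of p] s u h by auto
        moreover have "\<bar>J (t r) - I (t r) \<omega>\<bar> \<le> \<eta>" "\<bar>J (t p) - I (t p) \<omega>\<bar> \<le> \<eta>"
          using JI[OF t(2), of r] JI[OF t(2), of p] tr2 tp2 by auto
        moreover have "c \<le> \<bar>I u \<omega> - I s \<omega>\<bar>" using elim(4) wE by (simp add: s_def u_def)
        ultimately show ?thesis unfolding G using \<eta>(3) by linarith
      qed
      then show "\<omega> \<in> ?Z \<union> ?N" using elim(1) by blast
    qed
  qed
  then have "prob E \<le> prob (?Z \<union> ?N)"
    using N_events h1 h2 by (intro finite_measure_mono_AE) auto
  also have "\<dots> \<le> prob ?Z + (prob (NH j) + prob (NI j) + prob N1 + prob N2)"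
  proof -
    have "prob (?Z \<union> ?N) \<le> prob ?Z + prob ?N" using N_events h1 h2 by (intro measure_Un_le) auto
    moreover have "prob ?N \<le> prob (NH j \<union> NI j \<union> N1) + prob N2" using N_events h1 h2 by (intro measure_Un_le) auto
    moreover have "prob (NH j \<union> NI j \<union> N1) \<le> prob (NH j \<union> NI j) + prob N1" using N_events h1 h2 by (intro measure_Un_le) auto
    moreover have "prob (NH j \<union> NI j) \<le> prob (NH j) + prob (NI j)" using N_events by (intro measure_Un_le) auto
    ultimately show ?thesis by linarith
  qed
  also have "\<dots> \<le> q / (c / 2)\<^sup>2 * prob {\<omega>\<in>space M. \<sigma> \<omega> < \<theta> \<omega>} + e"
    using tail(2) N h1 h2 by (simp add: \<epsilon>_def)
  also have "q / (c / 2)\<^sup>2 = 40 * k * T / c\<^sup>2" by (simp add: q_def power_divide)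
  finally show "prob E \<le> 40 * k * T / c\<^sup>2 * prob {\<omega>\<in>space M. \<sigma> \<omega> < \<theta> \<omega>} + e" .
qed

end

section \<open>Hitting times and running maxima\<close>

text \<open>The infimum runs over rational times, so that \<open>hitting_time X l < t\<close> is a countable union of events
  for every process; for continuous paths the infimum over all times is the same.\<close>

definition hitting_time :: "(real \<Rightarrow> 'a \<Rightarrow> real) \<Rightarrow> real \<Rightarrow> 'a \<Rightarrow> ennreal" where
  "hitting_time X l \<omega> = (INF s\<in>{s\<in>\<rat>. 0 \<le> s \<and> l < X s \<omega>}. ennreal s)"

lemma hitting_time_less_iff:
  "hitting_time X l \<omega> < x \<longleftrightarrow> (\<exists>s\<in>\<rat>. 0 \<le> s \<and> l < X s \<omega> \<and> ennreal s < x)"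
  unfolding hitting_time_def by (auto simp: INF_less_iff)

text \<open>The event \<open>hitting_time X l < r\<close> is known at time \<open>r\<close>; right-continuity of the filtration passes to
  \<open>hitting_time X l \<le> t\<close>.\<close>

lemma (in usual_filtered_space) stopping_time_hitting_time:
  assumes X: "adapted Ft X"
  shows "stopping_time Ft (hitting_time X l)"
proof
  fix t :: ennreal
  show "Measurable.pred (Ft t) (\<lambda>\<omega>. hitting_time X l \<omega> \<le> t)"
  proof (cases "t = \<infinity>")
    case False
    then have t: "t < \<infinity>" by (simp add: less_top)
    have "{\<omega>\<in>space M. hitting_time X l \<omega> \<le> t} \<in> sets (Ft u)" if u: "t < u" for u
    proof -
      have "hitting_time X l \<omega> \<le> t \<longleftrightarrow>
          (\<forall>r::rat. t < ennreal (real_of_rat r) \<and> ennreal (real_of_rat r) < u \<longrightarrow> hitting_time X l \<omega> < ennreal (real_of_rat r))" for \<omega>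
      proof
        assume *: "\<forall>r::rat. t < ennreal (real_of_rat r) \<and> ennreal (real_of_rat r) < u \<longrightarrow> hitting_time X l \<omega> < ennreal (real_of_rat r)"
        show "hitting_time X l \<omega> \<le> t"
        proof (rule ccontr)
          assume "\<not> hitting_time X l \<omega> \<le> t"
          then have "t < min (hitting_time X l \<omega>) u" using u by simp
          then obtain r :: rat where "t < ennreal (real_of_rat r)" "ennreal (real_of_rat r) < min (hitting_time X l \<omega>) u"
            using ennreal_rat_dense by blast
          then show False using * by auto
        qed
      qed (auto intro: le_less_trans)
      then have "{\<omega>\<in>space M. hitting_time X l \<omega> \<le> t} =
          {\<omega>\<in>space (Ft u). \<forall>r::rat. t < ennreal (real_of_rat r) \<and> ennreal (real_of_rat r) < u \<longrightarrow>
            (\<exists>s\<in>{s\<in>\<rat>. 0 \<le> s \<and> ennreal s < ennreal (real_of_rat r)}. l < X s \<omega>)}"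
        by (auto simp: space_F hitting_time_less_iff)
      also have "\<dots> \<in> sets (Ft u)"
      proof -
        have "Measurable.pred (Ft u) (\<lambda>\<omega>. t < ennreal (real_of_rat r) \<and> ennreal (real_of_rat r) < u \<longrightarrow>
            (\<exists>s\<in>{s\<in>\<rat>. 0 \<le> s \<and> ennreal s < ennreal (real_of_rat r)}. l < X s \<omega>))" for r :: rat
        proof (cases "ennreal (real_of_rat r) < u")
          case True
          have "Measurable.pred (Ft u) (\<lambda>\<omega>. \<exists>s\<in>{s\<in>\<rat>. 0 \<le> s \<and> ennreal s < ennreal (real_of_rat r)}. l < X s \<omega>)"
          proof -
            let ?D = "{s\<in>\<rat>. 0 \<le> s \<and> ennreal s < ennreal (real_of_rat r)}"
            have "(\<Union>s\<in>?D. {\<omega>\<in>space (Ft u). l < X s \<omega>}) \<in> sets (Ft u)"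
            proof (rule sets.countable_UN'')
              show "countable ?D" by (rule countable_subset[OF _ countable_rat]) auto
              fix s assume s: "s \<in> ?D"
              then have "ennreal s \<le> u" using True by auto
              then have [measurable]: "X s \<in> borel_measurable (Ft u)"
                using X s measurable_Ft_mono unfolding adapted_def by blast
              show "{\<omega>\<in>space (Ft u). l < X s \<omega>} \<in> sets (Ft u)" by measurable
            qed
            moreover have "(\<Union>s\<in>?D. {\<omega>\<in>space (Ft u). l < X s \<omega>}) = {\<omega>\<in>space (Ft u). \<exists>s\<in>?D. l < X s \<omega>}"
              by blast
            ultimately show ?thesis by (simp add: pred_def)
          qed
          then show ?thesis by (intro pred_intros_logic) auto
        qed simp
        then have "Measurable.pred (Ft u) (\<lambda>\<omega>. \<forall>r::rat. t < ennreal (real_of_rat r) \<and> ennreal (real_of_rat r) < u \<longrightarrow>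
            (\<exists>s\<in>{s\<in>\<rat>. 0 \<le> s \<and> ennreal s < ennreal (real_of_rat r)}. l < X s \<omega>))"
          by (rule pred_intros_countable(1))
        then show ?thesis by (simp only: pred_def)
      qed
      finally show ?thesis .
    qed
    then have "{\<omega>\<in>space M. hitting_time X l \<omega> \<le> t} \<in> (\<Inter>u\<in>{t<..}. sets (Ft u))"
      by (intro INT_I) simp
    then have "{\<omega>\<in>space M. hitting_time X l \<omega> \<le> t} \<in> sets (Ft t)"
      by (simp only: right_cont[OF t])
    then show ?thesis by (simp add: pred_def space_F)
  qed simp
qed

lemma continuous_on_eventually_near:
  fixes f :: "real \<Rightarrow> real"
  assumes "continuous_on {0..} f" "0 \<le> s" "open O'" "f s \<in> O'"
  obtains d where "0 < d" "\<And>x. 0 \<le> x \<Longrightarrow> \<bar>x - s\<bar> < d \<Longrightarrow> f x \<in> O'"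
proof -
  obtain e where e: "0 < e" "ball (f s) e \<subseteq> O'" using assms(3,4) open_contains_ball by blast
  obtain d where "0 < d" "\<And>x. x \<in> {0..} \<Longrightarrow> dist x s < d \<Longrightarrow> dist (f x) (f s) < e"
    using assms(1,2) e(1) unfolding continuous_on_iff by (metis atLeast_iff)
  then show ?thesis using e that by (metis atLeast_iff dist_commute dist_real_def mem_ball subsetD)
qed

text \<open>Were \<open>X s > l\<close>, then continuity would give a rational time strictly before \<open>s\<close> with the same property;
  the assumption at time \<open>0\<close> leaves room to the left of \<open>s\<close>.\<close>

lemma before_hitting_time_le:
  assumes c: "continuous_on {0..} (\<lambda>t. X t \<omega>)" and X0: "X 0 \<omega> \<le> l" and s: "0 \<le> s" "ennreal s \<le> hitting_time X l \<omega>"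
  shows "X s \<omega> \<le> l"
proof (rule ccontr)
  assume "\<not> X s \<omega> \<le> l"
  then have Xs: "X s \<omega> \<in> {l<..}" by simp
  then have s0: "0 < s" using X0 s(1) by (cases "s = 0") auto
  obtain d where d: "0 < d" "\<And>x. 0 \<le> x \<Longrightarrow> \<bar>x - s\<bar> < d \<Longrightarrow> X x \<omega> \<in> {l<..}"
    using continuous_on_eventually_near[OF c s(1) open_greaterThan Xs] by blast
  define y where "y = max 0 (s - d / 2)"
  have y: "0 \<le> y" "y < s" "\<bar>y - s\<bar> < d" using d(1) s0 by (auto simp: y_def)
  obtain q where q: "q \<in> \<rat>" "0 \<le> q" "q \<le> y" "X q \<omega> \<in> {l<..}"
    using continuous_rational_witness[OF c y(1) open_greaterThan d(2)[OF y(1,3)]] by blast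
  then have "hitting_time X l \<omega> < ennreal s"
    unfolding hitting_time_less_iff using y by (intro bexI[of _ q]) (auto simp: ennreal_less_iff)
  then show False using s by simp
qed

lemma at_hitting_time_ge:
  assumes c: "continuous_on {0..} (\<lambda>t. X t \<omega>)" and s: "0 \<le> s" "hitting_time X l \<omega> = ennreal s"
  shows "l \<le> X s \<omega>"
proof (rule ccontr)
  assume "\<not> l \<le> X s \<omega>"
  then have Xs: "X s \<omega> \<in> {..<l}" by simp
  obtain d where d: "0 < d" "\<And>x. 0 \<le> x \<Longrightarrow> \<bar>x - s\<bar> < d \<Longrightarrow> X x \<omega> \<in> {..<l}"
    using continuous_on_eventually_near[OF c s(1) open_lessThan Xs] by blast
  have "hitting_time X l \<omega> < ennreal (s + d)" using s d(1) by (simp add: ennreal_less_iff)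
  then obtain q where q: "q \<in> \<rat>" "0 \<le> q" "l < X q \<omega>" "ennreal q < ennreal (s + d)"
    unfolding hitting_time_less_iff by blast
  moreover have "s \<le> q"
  proof (rule ccontr)
    assume "\<not> s \<le> q"
    then have "ennreal q < ennreal s" using q by (simp add: ennreal_less_iff)
    then have "hitting_time X l \<omega> < ennreal s" unfolding hitting_time_less_iff using q by blast
    then show False using s by simp
  qed
  ultimately have "\<bar>q - s\<bar> < d" by (simp add: ennreal_less_iff)
  from d(2)[OF q(2) this] q(3) show False by simp
qed

text \<open>A measurable version of \<^const>\<open>running_max\<close>, which agrees with it on continuous paths.\<close>

definition rational_max :: "(real \<Rightarrow> 'a \<Rightarrow> real) \<Rightarrow> ennreal \<Rightarrow> 'a \<Rightarrow> ennreal" where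
  "rational_max U t \<omega> = (SUP s\<in>{s\<in>\<rat>. 0 \<le> s \<and> ennreal s \<le> t}. ennreal \<bar>U s \<omega>\<bar>)"

lemma less_rational_max_iff:
  "0 \<le> x \<Longrightarrow> ennreal x < rational_max U t \<omega> \<longleftrightarrow> (\<exists>s\<in>\<rat>. 0 \<le> s \<and> ennreal s \<le> t \<and> x < \<bar>U s \<omega>\<bar>)"
  unfolding rational_max_def less_SUP_iff by (auto simp: ennreal_less_iff)

lemma running_max_eq_rational_max:
  assumes c: "continuous_on {0..} (\<lambda>t. U t \<omega>)"
  shows "running_max U t \<omega> = rational_max U t \<omega>"
proof (rule antisym)
  show "rational_max U t \<omega> \<le> running_max U t \<omega>"
    unfolding rational_max_def running_max_def by (intro SUP_subset_mono) auto
  show "running_max U t \<omega> \<le> rational_max U t \<omega>"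
    unfolding running_max_def
  proof (rule SUP_least)
    fix s assume "s \<in> {s. 0 \<le> s \<and> ennreal s \<le> t}"
    then have s: "0 \<le> s" "ennreal s \<le> t" by auto
    show "ennreal \<bar>U s \<omega>\<bar> \<le> rational_max U t \<omega>"
    proof (rule ccontr)
      assume n: "\<not> ennreal \<bar>U s \<omega>\<bar> \<le> rational_max U t \<omega>"
      then obtain x where x: "rational_max U t \<omega> = ennreal x" "0 \<le> x"
        by (cases "rational_max U t \<omega>") auto
      then have "\<bar>U s \<omega>\<bar> \<in> {x<..}" using n by (simp add: not_le ennreal_less_iff)
      moreover have "continuous_on {0..} (\<lambda>t. \<bar>U t \<omega>\<bar>)" using c by (intro continuous_intros)
      ultimately obtain q where q: "q \<in> \<rat>" "0 \<le> q" "q \<le> s" "\<bar>U q \<omega>\<bar> \<in> {x<..}"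
        using continuous_rational_witness[of "\<lambda>t. \<bar>U t \<omega>\<bar>" s "{x<..}"] s by auto
      then have "ennreal q \<le> t" using s by (meson ennreal_leI order_trans)
      then have "ennreal x < rational_max U t \<omega>"
        unfolding less_rational_max_iff[OF x(2)] using q by auto
      then show False using x by simp
    qed
  qed
qed

lemma rational_max_measurable:
  assumes U: "\<And>s. 0 \<le> s \<Longrightarrow> U s \<in> borel_measurable M" and \<tau>[measurable]: "\<tau> \<in> borel_measurable M"
  shows "(\<lambda>\<omega>. rational_max U (\<tau> \<omega>) \<omega>) \<in> borel_measurable M"
proof -
  have "rational_max U t \<omega> = (SUP s\<in>\<rat> \<inter> {0..}. if ennreal s \<le> t then ennreal \<bar>U s \<omega>\<bar> else 0)" for t \<omega>
    unfolding rational_max_def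
  proof (rule antisym)
    show "(SUP s\<in>{s\<in>\<rat>. 0 \<le> s \<and> ennreal s \<le> t}. ennreal \<bar>U s \<omega>\<bar>) \<le> (SUP s\<in>\<rat> \<inter> {0..}. if ennreal s \<le> t then ennreal \<bar>U s \<omega>\<bar> else 0)"
      by (intro SUP_mono) auto
    show "(SUP s\<in>\<rat> \<inter> {0..}. if ennreal s \<le> t then ennreal \<bar>U s \<omega>\<bar> else 0) \<le> (SUP s\<in>{s\<in>\<rat>. 0 \<le> s \<and> ennreal s \<le> t}. ennreal \<bar>U s \<omega>\<bar>)"
      by (intro SUP_least) (auto intro: SUP_upper)
  qed
  moreover have "(\<lambda>\<omega>. SUP s\<in>\<rat> \<inter> {0..}. if ennreal s \<le> \<tau> \<omega> then ennreal \<bar>U s \<omega>\<bar> else 0) \<in> borel_measurable M"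
  proof (rule borel_measurable_SUP)
    show "countable (\<rat> \<inter> {0::real..})" using countable_rat by blast
    fix s :: real assume "s \<in> \<rat> \<inter> {0..}"
    then have [measurable]: "U s \<in> borel_measurable M" using U by auto
    show "(\<lambda>\<omega>. if ennreal s \<le> \<tau> \<omega> then ennreal \<bar>U s \<omega>\<bar> else 0) \<in> borel_measurable M" by measurable
  qed
  ultimately show ?thesis by simp
qed

lemma less_esqrt_iff: "0 \<le> x \<Longrightarrow> ennreal x < esqrt t \<longleftrightarrow> ennreal (x\<^sup>2) < t"
  using real_sqrt_less_iff[of "x\<^sup>2"]
  by (cases t) (simp_all add: esqrt_def ennreal_less_iff del: real_sqrt_less_iff)

lemma esqrt_measurable [measurable]: "esqrt \<in> borel_measurable borel"
  unfolding esqrt_def[abs_def] by measurable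

section \<open>Bessel processes\<close>

context usual_filtered_space
begin

text \<open>Integrals of simple processes vanish at time \<open>0\<close>, so their limit in probability there is \<open>0\<close>.\<close>

lemma ito_integral_zero:
  assumes "ito_integral M Ft B H I"
  shows "AE \<omega> in M. I 0 \<omega> = 0"
proof -
  obtain S :: "nat \<Rightarrow> 'a simple" where S: "\<And>k. is_simple Ft (S k)"
    and conv: "tendsto_zero_in_prob M (\<lambda>k \<omega>. SUP s\<in>{0..0}. ennreal \<bar>simple_integral B (S k) s \<omega> - I s \<omega>\<bar>)"
    using assms unfolding ito_integral_def by blast
  have "simple_integral B (S k) 0 \<omega> = 0" for k \<omega>
  proof -
    have "(case e of (a, b, \<xi>) \<Rightarrow> \<xi> \<omega> * (B (min b 0) \<omega> - B (min a 0) \<omega>)) = 0" if "e \<in> set (S k)" for e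
    proof -
      obtain a b \<xi> where e: "e = (a, b, \<xi>)" by (cases e)
      have "0 \<le> a" "a \<le> b" using S[of k] that unfolding is_simple_def e by auto
      then show ?thesis by (simp add: e min_absorb2)
    qed
    then have "map (\<lambda>(a, b, \<xi>). \<xi> \<omega> * (B (min b 0) \<omega> - B (min a 0) \<omega>)) (S k) = map (\<lambda>_. 0) (S k)"
      by (intro map_cong refl)
    then show ?thesis unfolding simple_integral_def by (simp only: sum_list_0)
  qed
  then have conv: "tendsto_zero_in_prob M (\<lambda>k \<omega>. ennreal \<bar>I 0 \<omega>\<bar>)" using conv by simp
  then have [measurable]: "(\<lambda>\<omega>. ennreal \<bar>I 0 \<omega>\<bar>) \<in> borel_measurable M"
    unfolding tendsto_zero_in_prob_def by blast
  have "AE \<omega> in M. \<not> ennreal \<bar>I 0 \<omega>\<bar> > ennreal (inverse (real (Suc n)))" for n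
  proof -
    have "0 < inverse (real (Suc n))" by (intro positive_imp_inverse_positive) simp
    then have "(\<lambda>k::nat. prob {\<omega>\<in>space M. ennreal \<bar>I 0 \<omega>\<bar> > ennreal (inverse (real (Suc n)))}) \<longlonglongrightarrow> 0"
      using conv unfolding tendsto_zero_in_prob_def by blast
    then have "prob {\<omega>\<in>space M. ennreal \<bar>I 0 \<omega>\<bar> > ennreal (inverse (real (Suc n)))} = 0"
      by (simp add: LIMSEQ_const_iff)
    then have "AE \<omega> in M. \<omega> \<notin> {\<omega>\<in>space M. ennreal \<bar>I 0 \<omega>\<bar> > ennreal (inverse (real (Suc n)))}"
      by (subst (asm) prob_eq_0) auto
    then show ?thesis using AE_space by eventually_elim auto
  qed
  then have "AE \<omega> in M. \<forall>n. \<not> ennreal \<bar>I 0 \<omega>\<bar> > ennreal (inverse (real (Suc n)))"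
    by (simp only: AE_all_countable) blast
  then show ?thesis
  proof eventually_elim
    case (elim \<omega>)
    show ?case
    proof (rule ccontr)
      assume "I 0 \<omega> \<noteq> 0"
      then obtain n where "inverse (real (Suc n)) < \<bar>I 0 \<omega>\<bar>" using reals_Archimedean[of "\<bar>I 0 \<omega>\<bar>"] by auto
      then show False using elim by (auto simp: ennreal_less_iff simp del: of_nat_Suc)
    qed
  qed
qed

lemma squared_bessel_paths:
  assumes "squared_bessel M Ft B \<alpha> Y"
  obtains I where "ito_integral M Ft B (\<lambda>t \<omega>. 2 * sqrt (Y t \<omega>)) I"
    and "continuous_adapted M Ft (\<lambda>t \<omega>. 2 * sqrt (Y t \<omega>))"
    and "AE \<omega> in M. continuous_on {0..} (\<lambda>t. Y t \<omega>) \<and> Y 0 \<omega> = 0 \<and> (\<forall>t\<ge>0. 0 \<le> Y t \<omega> \<and> Y t \<omega> = \<alpha> * t + I t \<omega>)"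
proof -
  from assms obtain I where Y: "continuous_adapted M Ft Y" and pos: "AE \<omega> in M. \<forall>t\<ge>0. 0 \<le> Y t \<omega>"
    and I: "ito_integral M Ft B (\<lambda>t \<omega>. 2 * sqrt (Y t \<omega>)) I" and eq: "AE \<omega> in M. \<forall>t\<ge>0. Y t \<omega> = \<alpha> * t + I t \<omega>"
    unfolding squared_bessel_def by blast
  have cont: "AE \<omega> in M. continuous_on {0..} (\<lambda>t. Y t \<omega>)" using Y unfolding continuous_adapted_def by blast
  have "AE \<omega> in M. continuous_on {0..} (\<lambda>t. Y t \<omega>) \<and> Y 0 \<omega> = 0 \<and> (\<forall>t\<ge>0. 0 \<le> Y t \<omega> \<and> Y t \<omega> = \<alpha> * t + I t \<omega>)"
    using cont pos eq ito_integral_zero[OF I]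
  proof eventually_elim
    case (elim \<omega>)
    then have "Y 0 \<omega> = \<alpha> * 0 + I 0 \<omega>" by blast
    then show ?case using elim by simp
  qed
  moreover have "continuous_adapted M Ft (\<lambda>t \<omega>. 2 * sqrt (Y t \<omega>))"
    unfolding continuous_adapted_def
  proof
    have "(\<lambda>\<omega>. 2 * sqrt (Y t \<omega>)) \<in> borel_measurable (Ft (ennreal t))" if "0 \<le> t" for t
    proof -
      have [measurable]: "Y t \<in> borel_measurable (Ft (ennreal t))"
        using Y that unfolding continuous_adapted_def adapted_def by blast
      show ?thesis by measurable
    qed
    then show "adapted Ft (\<lambda>t \<omega>. 2 * sqrt (Y t \<omega>))" unfolding adapted_def by blast
    show "AE \<omega> in M. continuous_on {0..} (\<lambda>t. 2 * sqrt (Y t \<omega>))"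
      using cont by eventually_elim (intro continuous_intros)
  qed
  ultimately show ?thesis using that I by blast
qed

lemma bessel_measurable:
  assumes "bessel_process M Ft B \<alpha> U" "0 \<le> t"
  shows "U t \<in> borel_measurable M"
proof -
  obtain Y where Y: "squared_bessel M Ft B \<alpha> Y" and U: "\<forall>t\<ge>0. \<forall>\<omega>\<in>space M. U t \<omega> = sqrt (Y t \<omega>)"
    using assms unfolding bessel_process_def by blast
  have [measurable]: "Y t \<in> borel_measurable M"
    using Y assms(2) measurable_Ft_M unfolding squared_bessel_def continuous_adapted_def adapted_def by blast
  have "(\<lambda>\<omega>. sqrt (Y t \<omega>)) \<in> borel_measurable M" by measurable
  then show ?thesis using U assms(2) by (subst measurable_cong[where g="\<lambda>\<omega>. sqrt (Y t \<omega>)"]) auto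
qed

lemma stopping_time_measurable_M:
  "stopping_time Ft \<tau> \<Longrightarrow> \<tau> \<in> borel_measurable M"
  using measurable_stopping_time[of Ft \<tau> M] sub_M by (auto simp: subalgebra_def)

text \<open>If \<open>U\<close> exceeds \<open>2l\<close> before \<open>\<tau>\<close> and \<open>\<tau> \<le> \<delta>\<^sup>2l\<^sup>2\<close>, then \<open>Y = U\<^sup>2\<close> climbs from \<open>m = l\<^sup>2\<close> to \<open>4m\<close> within a
  time \<open>\<delta>\<^sup>2m\<close>. The drift contributes at most \<open>\<alpha>\<delta>\<^sup>2m \<le> m\<close>, so the Ito integral must grow by at least \<open>2m\<close>
  while its squared integrand \<open>4Y\<close> is at most \<open>16m\<close>.\<close>

lemma bessel_max_good_lambda:
  assumes bm: "brownian_motion M Ft B" and bessel: "bessel_process M Ft B \<alpha> U" and \<tau>: "stopping_time Ft \<tau>"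
    and \<alpha>: "0 < \<alpha>" and l: "0 < l" and \<delta>: "0 < \<delta>" "\<alpha> * \<delta>\<^sup>2 \<le> 1"
  shows "prob {\<omega>\<in>space M. ennreal (2 * l) < rational_max U (\<tau> \<omega>) \<omega> \<and> esqrt (\<tau> \<omega>) \<le> ennreal (\<delta> * l)}
    \<le> 160 * \<delta>\<^sup>2 * prob {\<omega>\<in>space M. ennreal l < rational_max U (\<tau> \<omega>) \<omega>}" (is "prob ?E \<le> _ * prob ?R")
proof -
  obtain Y where Y: "squared_bessel M Ft B \<alpha> Y" and U: "\<forall>t\<ge>0. \<forall>\<omega>\<in>space M. U t \<omega> = sqrt (Y t \<omega>)"
    using bessel unfolding bessel_process_def by blast
  obtain I where I: "ito_integral M Ft B (\<lambda>t \<omega>. 2 * sqrt (Y t \<omega>)) I"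
    and H: "continuous_adapted M Ft (\<lambda>t \<omega>. 2 * sqrt (Y t \<omega>))"
    and paths: "AE \<omega> in M. continuous_on {0..} (\<lambda>t. Y t \<omega>) \<and> Y 0 \<omega> = 0 \<and> (\<forall>t\<ge>0. 0 \<le> Y t \<omega> \<and> Y t \<omega> = \<alpha> * t + I t \<omega>)"
    using squared_bessel_paths[OF Y] by blast
  have Yad: "adapted Ft Y" using Y unfolding squared_bessel_def continuous_adapted_def by blast
  define m where "m = l\<^sup>2"
  have m: "0 < m" using l by (simp add: m_def)
  define T where "T = \<delta>\<^sup>2 * m"
  have T: "0 < T" "\<alpha> * T \<le> m"
    using \<delta> m mult_right_mono[OF \<delta>(2), of m] by (simp_all add: T_def mult.assoc)
  define \<sigma> where "\<sigma> = hitting_time Y m"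
  define \<rho> where "\<rho> = hitting_time Y (4 * m)"
  define \<theta> where "\<theta> \<omega> = min (min (\<tau> \<omega>) (\<rho> \<omega>)) (ennreal T)" for \<omega>
  have st: "stopping_time Ft \<sigma>" "stopping_time Ft \<theta>"
    unfolding \<sigma>_def \<theta>_def \<rho>_def
    by (intro stopping_time_min stopping_time_hitting_time stopping_time_const Yad \<tau>)+
  have [measurable]: "\<tau> \<in> borel_measurable M" "(\<lambda>\<omega>. rational_max U (\<tau> \<omega>) \<omega>) \<in> borel_measurable M"
    using stopping_time_measurable_M[OF \<tau>] rational_max_measurable[OF bessel_measurable[OF bessel]] by auto
  have E: "?E \<in> events" by measurable
  have facts: "AE \<omega> in M. \<omega> \<in> ?E \<longrightarrow> \<sigma> \<omega> < \<theta> \<omega> \<and>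
      (\<forall>s\<ge>0. \<sigma> \<omega> \<le> ennreal s \<and> ennreal s \<le> \<theta> \<omega> \<longrightarrow> (2 * sqrt (Y s \<omega>))\<^sup>2 \<le> 16 * m) \<and>
      2 * m \<le> \<bar>I (enn2real (\<theta> \<omega>)) \<omega> - I (enn2real (\<sigma> \<omega>)) \<omega>\<bar>"
    using paths
  proof eventually_elim
    case (elim \<omega>)
    then have c: "continuous_on {0..} (\<lambda>t. Y t \<omega>)" and Y0: "Y 0 \<omega> = 0"
      and pos: "\<And>t. 0 \<le> t \<Longrightarrow> 0 \<le> Y t \<omega>" and eq: "\<And>t. 0 \<le> t \<Longrightarrow> Y t \<omega> = \<alpha> * t + I t \<omega>" by blast+
    show ?case
    proof
      assume "\<omega> \<in> ?E"
      then have w: "\<omega> \<in> space M" and max: "ennreal (2 * l) < rational_max U (\<tau> \<omega>) \<omega>"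
        and small: "\<not> ennreal (\<delta> * l) < esqrt (\<tau> \<omega>)" by (auto simp: not_less)
      have \<tau>T: "\<tau> \<omega> \<le> ennreal T"
        using small \<delta> l by (subst (asm) less_esqrt_iff) (auto simp: not_less T_def m_def power_mult_distrib)
      obtain q where q: "0 \<le> q" "ennreal q \<le> \<tau> \<omega>" "2 * l < \<bar>U q \<omega>\<bar>"
        using max l by (subst (asm) less_rational_max_iff) auto
      have Yq: "4 * m < Y q \<omega>"
      proof -
        have "2 * l < sqrt (Y q \<omega>)" using q U w pos by simp
        then have "(2 * l)\<^sup>2 < (sqrt (Y q \<omega>))\<^sup>2" using l by (intro power_strict_mono) auto
        then show ?thesis using pos[OF q(1)] by (simp add: m_def power_mult_distrib)
      qed
      have before: "Y s \<omega> \<le> x" if "0 \<le> s" "ennreal s \<le> hitting_time Y x \<omega>" "0 \<le> x" for s x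
        using before_hitting_time_le[where X=Y and \<omega>=\<omega>, OF c _ that(1,2)] Y0 that(3) by simp
      have "\<rho> \<omega> < ennreal q"
        using before[OF q(1), of "4 * m"] Yq m unfolding \<rho>_def by (auto simp: not_le[symmetric])
      then have \<rho>\<tau>: "\<rho> \<omega> < \<tau> \<omega>" using q(2) by simp
      then obtain u where u: "\<rho> \<omega> = ennreal u" "0 \<le> u" by (cases "\<rho> \<omega>") auto
      have \<theta>: "\<theta> \<omega> = ennreal u" using less_imp_le[OF \<rho>\<tau>] \<tau>T unfolding \<theta>_def u by (simp add: min_absorb1 min_absorb2)
      have uT: "u \<le> T"
        using \<rho>\<tau> \<tau>T T u by (metis ennreal_le_iff less_imp_le order_trans)
      have Yu: "4 * m \<le> Y u \<omega>" using at_hitting_time_ge[where X=Y and \<omega>=\<omega> and l="4 * m", OF c u(2)] u(1) unfolding \<rho>_def by blast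
      have \<sigma>u: "\<sigma> \<omega> < ennreal u"
        using before[OF u(2), of m] Yu m unfolding \<sigma>_def by (auto simp: not_le[symmetric])
      then obtain s where s: "\<sigma> \<omega> = ennreal s" "0 \<le> s" by (cases "\<sigma> \<omega>") auto
      have su: "s < u" using \<sigma>u s by (simp add: ennreal_less_iff)
      have Ys: "Y s \<omega> \<le> m" using before[OF s(2), of m] s(1) m unfolding \<sigma>_def by simp
      have "2 * m \<le> I u \<omega> - I s \<omega>"
      proof -
        have "\<alpha> * u - \<alpha> * s \<le> \<alpha> * T"
          using mult_left_mono[OF uT, of \<alpha>] \<alpha> s(2) by (smt (verit) mult_nonneg_nonneg)
        then show ?thesis using Yu Ys eq[OF u(2)] eq[OF s(2)] T(2) by linarith
      qed
      moreover have "(2 * sqrt (Y x \<omega>))\<^sup>2 \<le> 16 * m" if x: "0 \<le> x" "ennreal x \<le> \<theta> \<omega>" for x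
      proof -
        have "Y x \<omega> \<le> 4 * m" using before[OF x(1), of "4 * m"] x(2) m unfolding \<theta> u(1)[symmetric] \<rho>_def by simp
        then show ?thesis using pos[OF x(1)] by (simp add: power_mult_distrib)
      qed
      ultimately show "\<sigma> \<omega> < \<theta> \<omega> \<and>
        (\<forall>s\<ge>0. \<sigma> \<omega> \<le> ennreal s \<and> ennreal s \<le> \<theta> \<omega> \<longrightarrow> (2 * sqrt (Y s \<omega>))\<^sup>2 \<le> 16 * m) \<and>
        2 * m \<le> \<bar>I (enn2real (\<theta> \<omega>)) \<omega> - I (enn2real (\<sigma> \<omega>)) \<omega>\<bar>"
        using \<sigma>u s u by (simp add: \<theta>)
    qed
  qed
  have "prob ?E \<le> 40 * (16 * m) * T / (2 * m)\<^sup>2 * prob {\<omega>\<in>space M. \<sigma> \<omega> < \<theta> \<omega>}"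
  proof (rule ito_increment_tail[OF bm I H st T(1) _ _ _ E])
    show "\<theta> \<omega> \<le> ennreal T" for \<omega> by (simp add: \<theta>_def)
  qed (use m facts in auto)
  also have "40 * (16 * m) * T / (2 * m)\<^sup>2 = 160 * \<delta>\<^sup>2"
    using m by (simp add: T_def power2_eq_square)
  also have "160 * \<delta>\<^sup>2 * prob {\<omega>\<in>space M. \<sigma> \<omega> < \<theta> \<omega>} \<le> 160 * \<delta>\<^sup>2 * prob ?R"
  proof (intro mult_left_mono finite_measure_mono subsetI)
    fix \<omega> assume "\<omega> \<in> {\<omega>\<in>space M. \<sigma> \<omega> < \<theta> \<omega>}"
    then have w: "\<omega> \<in> space M" and "\<sigma> \<omega> < \<tau> \<omega>" by (auto simp: \<theta>_def)
    then obtain q where q: "q \<in> \<rat>" "0 \<le> q" "m < Y q \<omega>" "ennreal q < \<tau> \<omega>"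
      unfolding \<sigma>_def hitting_time_less_iff by blast
    have "l < sqrt (Y q \<omega>)" using q(3) by (simp add: m_def real_less_rsqrt)
    then have "l < \<bar>U q \<omega>\<bar>" using U w q(2) by simp
    then have "ennreal l < rational_max U (\<tau> \<omega>) \<omega>"
      using q l by (subst less_rational_max_iff) auto
    then show "\<omega> \<in> ?R" using w by simp
  qed auto
  finally show ?thesis .
qed

text \<open>If \<open>\<tau> > 4m\<close> with \<open>m = l\<^sup>2\<close> and \<open>Y = U\<^sup>2\<close> stays below \<open>\<delta>\<^sup>2m\<close>, then over \<open>[m, 4m]\<close> the Ito integral has to
  cancel the drift \<open>3\<alpha>m\<close> up to \<open>\<delta>\<^sup>2m \<le> \<alpha>m\<close>, although its squared integrand is at most \<open>4\<delta>\<^sup>2m\<close>. This is where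
  the drift of the squared process, hence \<open>\<alpha> > 0\<close>, enters.\<close>

lemma bessel_clock_good_lambda:
  assumes bm: "brownian_motion M Ft B" and bessel: "bessel_process M Ft B \<alpha> U" and \<tau>: "stopping_time Ft \<tau>"
    and \<alpha>: "0 < \<alpha>" and l: "0 < l" and \<delta>: "0 < \<delta>" "\<delta>\<^sup>2 \<le> \<alpha>"
  shows "prob {\<omega>\<in>space M. ennreal (2 * l) < esqrt (\<tau> \<omega>) \<and> rational_max U (\<tau> \<omega>) \<omega> \<le> ennreal (\<delta> * l)}
    \<le> 160 * \<delta>\<^sup>2 / \<alpha>\<^sup>2 * prob {\<omega>\<in>space M. ennreal l < esqrt (\<tau> \<omega>)}" (is "prob ?E \<le> _ * prob ?R")
proof -
  obtain Y where Y: "squared_bessel M Ft B \<alpha> Y" and U: "\<forall>t\<ge>0. \<forall>\<omega>\<in>space M. U t \<omega> = sqrt (Y t \<omega>)"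
    using bessel unfolding bessel_process_def by blast
  obtain I where I: "ito_integral M Ft B (\<lambda>t \<omega>. 2 * sqrt (Y t \<omega>)) I"
    and H: "continuous_adapted M Ft (\<lambda>t \<omega>. 2 * sqrt (Y t \<omega>))"
    and paths: "AE \<omega> in M. continuous_on {0..} (\<lambda>t. Y t \<omega>) \<and> Y 0 \<omega> = 0 \<and> (\<forall>t\<ge>0. 0 \<le> Y t \<omega> \<and> Y t \<omega> = \<alpha> * t + I t \<omega>)"
    using squared_bessel_paths[OF Y] by blast
  define m where "m = l\<^sup>2"
  have m: "0 < m" using l by (simp add: m_def)
  define d where "d = \<delta>\<^sup>2 * m"
  have d: "0 < d" "d \<le> \<alpha> * m" using \<delta> m by (simp_all add: d_def)
  define \<sigma> :: "'a \<Rightarrow> ennreal" where "\<sigma> \<omega> = ennreal m" for \<omega>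
  define \<theta> where "\<theta> \<omega> = min (\<tau> \<omega>) (ennreal (4 * m))" for \<omega>
  have st: "stopping_time Ft \<sigma>" "stopping_time Ft \<theta>"
    unfolding \<sigma>_def \<theta>_def by (intro stopping_time_min stopping_time_const \<tau>)+
  have [measurable]: "\<tau> \<in> borel_measurable M" "(\<lambda>\<omega>. rational_max U (\<tau> \<omega>) \<omega>) \<in> borel_measurable M"
    using stopping_time_measurable_M[OF \<tau>] rational_max_measurable[OF bessel_measurable[OF bessel]] by auto
  have E: "?E \<in> events" by measurable
  have facts: "AE \<omega> in M. \<omega> \<in> ?E \<longrightarrow> \<sigma> \<omega> < \<theta> \<omega> \<and>
      (\<forall>s\<ge>0. \<sigma> \<omega> \<le> ennreal s \<and> ennreal s \<le> \<theta> \<omega> \<longrightarrow> (2 * sqrt (Y s \<omega>))\<^sup>2 \<le> 4 * d) \<and>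
      2 * \<alpha> * m \<le> \<bar>I (enn2real (\<theta> \<omega>)) \<omega> - I (enn2real (\<sigma> \<omega>)) \<omega>\<bar>"
    using paths
  proof eventually_elim
    case (elim \<omega>)
    then have c: "continuous_on {0..} (\<lambda>t. Y t \<omega>)"
      and pos: "\<And>t. 0 \<le> t \<Longrightarrow> 0 \<le> Y t \<omega>" and eq: "\<And>t. 0 \<le> t \<Longrightarrow> Y t \<omega> = \<alpha> * t + I t \<omega>" by blast+
    show ?case
    proof
      assume "\<omega> \<in> ?E"
      then have w: "\<omega> \<in> space M" and large: "ennreal (2 * l) < esqrt (\<tau> \<omega>)"
        and small: "\<not> ennreal (\<delta> * l) < rational_max U (\<tau> \<omega>) \<omega>" by (auto simp: not_less)
      have \<tau>m: "ennreal (4 * m) < \<tau> \<omega>"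
        using large l by (subst (asm) less_esqrt_iff) (auto simp: m_def power_mult_distrib)
      then have \<theta>: "\<theta> \<omega> = ennreal (4 * m)" by (simp add: \<theta>_def min_absorb2)
      have Yd: "Y s \<omega> \<le> d" if s: "0 \<le> s" "ennreal s \<le> \<tau> \<omega>" for s
      proof (rule ccontr)
        assume "\<not> Y s \<omega> \<le> d"
        then obtain q where q: "q \<in> \<rat>" "0 \<le> q" "q \<le> s" "d < Y q \<omega>"
          using continuous_rational_witness[OF c s(1) open_greaterThan, of d] by auto
        have "\<delta> * l < sqrt (Y q \<omega>)"
          using q(4) by (intro real_less_rsqrt) (simp add: d_def m_def power_mult_distrib)
        then have "\<delta> * l < \<bar>U q \<omega>\<bar>" using U w q(2) by simp
        moreover have "ennreal q \<le> \<tau> \<omega>" using q(3) s(2) by (meson ennreal_leI order_trans)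
        ultimately have "ennreal (\<delta> * l) < rational_max U (\<tau> \<omega>) \<omega>"
          using q \<delta> l by (subst less_rational_max_iff) auto
        then show False using small by simp
      qed
      have "I (4 * m) \<omega> - I m \<omega> \<le> - (2 * \<alpha> * m)"
      proof -
        have "Y (4 * m) \<omega> \<le> d" using m \<tau>m by (intro Yd) auto
        then show ?thesis using pos[of m] eq[of m] eq[of "4 * m"] m d(2) by (simp add: algebra_simps)
      qed
      moreover have "(2 * sqrt (Y x \<omega>))\<^sup>2 \<le> 4 * d" if x: "0 \<le> x" "ennreal x \<le> \<theta> \<omega>" for x
        using Yd[OF x(1)] x(2) pos[OF x(1)] by (simp add: power_mult_distrib \<theta>_def)
      ultimately show "\<sigma> \<omega> < \<theta> \<omega> \<and>
        (\<forall>s\<ge>0. \<sigma> \<omega> \<le> ennreal s \<and> ennreal s \<le> \<theta> \<omega> \<longrightarrow> (2 * sqrt (Y s \<omega>))\<^sup>2 \<le> 4 * d) \<and>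
        2 * \<alpha> * m \<le> \<bar>I (enn2real (\<theta> \<omega>)) \<omega> - I (enn2real (\<sigma> \<omega>)) \<omega>\<bar>"
        using m by (auto simp: \<theta> \<sigma>_def ennreal_less_iff)
    qed
  qed
  have "prob ?E \<le> 40 * (4 * d) * (4 * m) / (2 * \<alpha> * m)\<^sup>2 * prob {\<omega>\<in>space M. \<sigma> \<omega> < \<theta> \<omega>}"
  proof (rule ito_increment_tail[OF bm I H st _ _ _ _ E])
    show "\<theta> \<omega> \<le> ennreal (4 * m)" for \<omega> by (simp add: \<theta>_def)
  qed (use m d \<alpha> facts in auto)
  also have "40 * (4 * d) * (4 * m) / (2 * \<alpha> * m)\<^sup>2 = 160 * \<delta>\<^sup>2 / \<alpha>\<^sup>2"
    using m \<alpha> by (simp add: d_def power2_eq_square)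
  also have "160 * \<delta>\<^sup>2 / \<alpha>\<^sup>2 * prob {\<omega>\<in>space M. \<sigma> \<omega> < \<theta> \<omega>} \<le> 160 * \<delta>\<^sup>2 / \<alpha>\<^sup>2 * prob ?R"
    using l by (intro mult_left_mono finite_measure_mono subsetI)
      (auto simp: \<theta>_def \<sigma>_def less_esqrt_iff m_def)
  finally show ?thesis .
qed

lemma bessel_running_max_eq:
  assumes "bessel_process M Ft B \<alpha> U"
  shows "AE \<omega> in M. running_max U (\<tau> \<omega>) \<omega> = rational_max U (\<tau> \<omega>) \<omega>"
proof -
  obtain Y where Y: "squared_bessel M Ft B \<alpha> Y" and U: "\<forall>t\<ge>0. \<forall>\<omega>\<in>space M. U t \<omega> = sqrt (Y t \<omega>)"
    using assms unfolding bessel_process_def by blast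
  have "AE \<omega> in M. continuous_on {0..} (\<lambda>t. Y t \<omega>)"
    using Y unfolding squared_bessel_def continuous_adapted_def by blast
  then show ?thesis
    using AE_space
  proof eventually_elim
    case (elim \<omega>)
    then have "continuous_on {0..} (\<lambda>t. sqrt (Y t \<omega>))" by (intro continuous_intros)
    then have "continuous_on {0..} (\<lambda>t. U t \<omega>)"
      using U elim by (subst continuous_on_cong[OF refl, where g="\<lambda>t. sqrt (Y t \<omega>)"]) auto
    then show ?case by (rule running_max_eq_rational_max)
  qed
qed

end

theorem corollary6p6:
  fixes \<alpha> :: real and F :: "real \<Rightarrow> real"
  assumes "\<alpha> > 0" and "moderate F"
  shows "\<exists>c>0. \<exists>C>0.
    \<forall>(M :: 'a measure) (Ft :: ennreal \<Rightarrow> 'a measure) (B :: real \<Rightarrow> 'a \<Rightarrow> real)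
      (U :: real \<Rightarrow> 'a \<Rightarrow> real) (\<tau> :: 'a \<Rightarrow> ennreal).
      usual_filtered_space M Ft \<longrightarrow> brownian_motion M Ft B \<longrightarrow> bessel_process M Ft B \<alpha> U \<longrightarrow>
      stopping_time Ft \<tau> \<longrightarrow>
        ennreal c * (\<integral>\<^sup>+\<omega>. ext_inf F (esqrt (\<tau> \<omega>)) \<partial>M)
          \<le> (\<integral>\<^sup>+\<omega>. ext_inf F (running_max U (\<tau> \<omega>) \<omega>) \<partial>M) \<and>
        (\<integral>\<^sup>+\<omega>. ext_inf F (running_max U (\<tau> \<omega>) \<omega>) \<partial>M)
          \<le> ennreal C * (\<integral>\<^sup>+\<omega>. ext_inf F (esqrt (\<tau> \<omega>)) \<partial>M)"
proof -
  note \<alpha> = assms(1) and F = assms(2)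
  obtain K where K: "1 \<le> K" "\<And>x. 0 \<le> x \<Longrightarrow> F (2 * x) \<le> K * F x"
    using moderate_dilation[OF F, of 2] by auto
  \<comment> \<open>\<open>d = \<delta>\<^sup>2\<close> is small enough for both good-\<open>\<lambda>\<close> inequalities and for the absorption of \<open>160 * d\<close> and \<open>160 * d / \<alpha>\<^sup>2\<close>.\<close>
  define d where "d = Min {1 / (320 * K), 1 / \<alpha>, \<alpha>\<^sup>2 / (320 * K), \<alpha>}"
  have d: "0 < d" "d \<le> 1 / (320 * K)" "d \<le> 1 / \<alpha>" "d \<le> \<alpha>\<^sup>2 / (320 * K)" "d \<le> \<alpha>"
    using K \<alpha> by (auto simp: d_def)
  define \<delta> where "\<delta> = sqrt d"
  have \<delta>: "0 < \<delta>" "\<delta>\<^sup>2 = d" using d by (simp_all add: \<delta>_def)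
  have small: "\<alpha> * \<delta>\<^sup>2 \<le> 1" "\<delta>\<^sup>2 \<le> \<alpha>" "K * (160 * \<delta>\<^sup>2) \<le> 1 / 2" "K * (160 * \<delta>\<^sup>2 / \<alpha>\<^sup>2) \<le> 1 / 2"
    using d K \<alpha> unfolding \<delta>(2) by (auto simp: field_simps)
  obtain D where D: "1 \<le> D" "\<And>x. 0 \<le> x \<Longrightarrow> F (1 / \<delta> * x) \<le> D * F x"
    using moderate_dilation[OF F, of "1 / \<delta>"] \<delta> by auto
  define C where "C = 2 * K * D"
  have C: "0 < C" using K D by (simp add: C_def)
  have main: "ennreal (1 / C) * (\<integral>\<^sup>+\<omega>. ext_inf F (esqrt (\<tau> \<omega>)) \<partial>M)
        \<le> (\<integral>\<^sup>+\<omega>. ext_inf F (running_max U (\<tau> \<omega>) \<omega>) \<partial>M) \<and>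
      (\<integral>\<^sup>+\<omega>. ext_inf F (running_max U (\<tau> \<omega>) \<omega>) \<partial>M)
        \<le> ennreal C * (\<integral>\<^sup>+\<omega>. ext_inf F (esqrt (\<tau> \<omega>)) \<partial>M)"
    if ufs: "usual_filtered_space M Ft" and bm: "brownian_motion M Ft B"
      and U: "bessel_process M Ft B \<alpha> U" and \<tau>: "stopping_time Ft \<tau>"
    for M :: "'a measure" and Ft B U \<tau>
  proof
    interpret usual_filtered_space M Ft by (fact ufs)
    note \<tau>_meas[measurable] = stopping_time_measurable_M[OF \<tau>]
    have max_meas: "(\<lambda>\<omega>. rational_max U (\<tau> \<omega>) \<omega>) \<in> borel_measurable M"
      by (intro rational_max_measurable bessel_measurable[OF U] \<tau>_meas)
    have sqrt_meas: "(\<lambda>\<omega>. esqrt (\<tau> \<omega>)) \<in> borel_measurable M" by measurable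
    let ?A = "\<integral>\<^sup>+\<omega>. ext_inf F (running_max U (\<tau> \<omega>) \<omega>) \<partial>M"
    let ?T = "\<integral>\<^sup>+\<omega>. ext_inf F (esqrt (\<tau> \<omega>)) \<partial>M"
    have max_eq: "?A = (\<integral>\<^sup>+\<omega>. ext_inf F (rational_max U (\<tau> \<omega>) \<omega>) \<partial>M)"
      using bessel_running_max_eq[OF U, of \<tau>] by (intro nn_integral_cong_AE) (auto elim: eventually_mono)
    show "?A \<le> ennreal C * ?T"
      unfolding max_eq C_def
      by (rule good_lambda_moment_inequality[OF F max_meas sqrt_meas \<delta>(1) K D _ small(3)])
         (use bessel_max_good_lambda[OF bm U \<tau> \<alpha> _ \<delta>(1) small(1)] in auto)
    have "?T \<le> ennreal C * ?A"
      unfolding max_eq C_def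
      by (rule good_lambda_moment_inequality[OF F sqrt_meas max_meas \<delta>(1) K D _ small(4)])
         (use bessel_clock_good_lambda[OF bm U \<tau> \<alpha> _ \<delta>(1) small(2)] in auto)
    then have "ennreal (1 / C) * ?T \<le> ennreal (1 / C) * (ennreal C * ?A)"
      by (intro mult_left_mono) auto
    also have "\<dots> = ?A" using C by (simp add: mult.assoc[symmetric] ennreal_mult[symmetric])
    finally show "ennreal (1 / C) * ?T \<le> ?A" .
  qed
  have "0 < 1 / C" using C by simp
  then show ?thesis using main C by blast
qed

end
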